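(* Let $n\in\mathbb{N}$, let $\{y_i\}_{i=1}^N\subset(-1,1)$ be the snapshot set and $\{w_i\}_{i=1}^N\subset\mathbb{R}^+$ positive weights such that $(g,f)_D:=\sum_{i=1}^N g(y_i)f(y_i)w_i$ is an inner product on $\mathcal{P}^n([-1,1])$ and $\sum_{i=1}^N w_i=2$. Let $x(y)\in\mathbb{R}^m$ be the solution to $A(y)x(y)=b$ for $y\in(-1,1)$, and let $\tilde x(y)$ be the subspace solution from the Lagrange subspace $V(\{y_i\}_{i=1}^N)=\mathrm{span}\{x(y_1),\ldots,x(y_N)\}$. Assume that $e<1$, where $$e=\max_{q\in\mathcal{P}^n([-1,1])\setminus\{0\}}\left|\frac{\int_{-1}^1 q(y)^2\,dy-\sum_{i=1}^N q(y_i)^2 w_i}{\int_{-1}^1 q(y)^2\,dy}\right|.$$ Then $$\|x-\tilde x\|_{L^2(-1,1;\mathbb{R}^m_{A_0})}\le\kappa\left(\sqrt2+C_{\rm s}(n)\right)\min_{q\in\mathcal{P}^n([-1,1];\mathbb{R}^m)}\|x-q\|_{L^\infty(-1,1;\mathbb{R}^m_{A_0})},$$ where $\kappa=\left(\frac{1+C}{r}\right)^{1/2}$ and $C_{\rm s}(n)=\left(\frac{2n+2}{1-e}\right)^{1/2}$.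
   Context: Model problem. $\Omega\subset\mathbb{R}^d$, $d\in\{2,3\}$, is a domain with Lipschitz boundary; $L:H^1_0(\Omega)\to\mathbb{R}$ is a bounded linear functional; $a_0,a_1:H^1_0(\Omega)\times H^1_0(\Omega)\to\mathbb{R}$ are symmetric continuous bilinear forms, $a_0$ is coercive, $a_1$ is positive semidefinite, and $0<r<1$ is such that $a_1(v,v)\le(1-r)a_0(v,v)$ for all $v\in H^1_0(\Omega)$. $C>0$ is a constant such that $|a_1(v,z)|\le C\,a_0(v,v)^{1/2}a_0(z,z)^{1/2}$ for all $v,z\in H^1_0(\Omega)$. $X_h\subset H^1_0(\Omega)$ is a finite-dimensional (finite element) subspace with basis $\{\varphi_i\}_{i=1}^m$. Define $A_0,A_1\in\mathbb{R}^{m\times m}$ by $[A_0]_{ij}=a_0(\varphi_i,\varphi_j)$, $[A_1]_{ij}=a_1(\varphi_i,\varphi_j)$, set $A(y)=A_0+yA_1$ for $y\in(-1,1)$, and $b\in\mathbb{R}^m$, $b_i=L(\varphi_i)$. The matrices $A_0$ and $A(y)$ are symmetric positive definite. Subspace solution. For a subspace $V\subset\mathbb{R}^m$ with basis matrix $Q\in\mathbb{R}^{m\times k}$ (columns of $Q$ form a basis of $V$), the subspace solution of $A(y)x(y)=b$ from $V$ is $\tilde x(y)=Qz(y)$, where $Q^TA(y)Qz(y)=Q^Tb$. Norms and spaces. $\|z\|_{A_0}=(z^TA_0z)^{1/2}$, and $\mathbb{R}^m_{A_0}$ is $\mathbb{R}^m$ with this norm; $\|f\|_{L^2(-1,1;\mathbb{R}^m_{A_0})}=\left(\int_{-1}^1\|f(y)\|_{A_0}^2\,dy\right)^{1/2}$,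 $\|f\|_{L^\infty(-1,1;\mathbb{R}^m_{A_0})}=\operatorname{ess\,sup}_{y\in(-1,1)}\|f(y)\|_{A_0}$. $\mathcal{P}^n([-1,1])$ is the space of real polynomials of degree at most $n$ on $[-1,1]$, and $\mathcal{P}^n([-1,1];\mathbb{R}^m)$ the space of $\mathbb{R}^m$-valued functions with components in $\mathcal{P}^n([-1,1])$. *)

theory Defs
  imports
    "HOL-Analysis.Analysis"
    "HOL-Probability.Essential_Supremum"
    "HOL-Computational_Algebra.Polynomial"
begin

text \<open>
  Near every boundary point the set is the epigraph of a Lipschitz function, in the coordinates
  \<open>(z - (z \<bullet> \<nu>) \<nu>, z \<bullet> \<nu>)\<close> belonging to a unit vector \<open>\<nu>\<close>.
\<close>

definition lipschitz_boundary :: "'a::euclidean_space set \<Rightarrow> bool" where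
  "lipschitz_boundary \<Omega> \<longleftrightarrow>
     (\<forall>p \<in> frontier \<Omega>. \<exists>\<rho>>0. \<exists>\<nu> K. \<exists>\<gamma>::'a \<Rightarrow> real.
        norm \<nu> = 1 \<and> K-lipschitz_on {z. z \<bullet> \<nu> = 0} \<gamma> \<and>
        \<Omega> \<inter> ball p \<rho> = {z \<in> ball p \<rho>. \<gamma> (z - (z \<bullet> \<nu>) *\<^sub>R \<nu>) < z \<bullet> \<nu>})"

definition lipschitz_domain :: "'a::euclidean_space set \<Rightarrow> bool" where
  "lipschitz_domain \<Omega> \<longleftrightarrow> open \<Omega> \<and> connected \<Omega> \<and> \<Omega> \<noteq> {} \<and> lipschitz_boundary \<Omega>"

text \<open>
  Elements of the Lebesgue and Sobolev spaces over \<open>\<Omega>\<close> are represented by functions on the whole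
  space; only the almost everywhere class of the restriction to \<open>\<Omega>\<close> matters.
\<close>

primrec Ck :: "nat \<Rightarrow> ('a::euclidean_space \<Rightarrow> real) \<Rightarrow> bool" where
  "Ck 0 f \<longleftrightarrow> continuous_on UNIV f"
| "Ck (Suc k) f \<longleftrightarrow> (\<forall>z. f differentiable (at z)) \<and>
     (\<forall>b \<in> Basis. Ck k (\<lambda>z. frechet_derivative f (at z) b))"

definition test_functions :: "'a::euclidean_space set \<Rightarrow> ('a \<Rightarrow> real) set" where
  "test_functions \<Omega> = {f. (\<forall>k. Ck k f) \<and>
     compact (closure {z. f z \<noteq> 0}) \<and> closure {z. f z \<noteq> 0} \<subseteq> \<Omega>}"

definition L2 :: "'a::euclidean_space set \<Rightarrow> ('a \<Rightarrow> 'b::euclidean_space) set" where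
  "L2 \<Omega> = {u. u \<in> borel_measurable (lebesgue_on \<Omega>) \<and>
     integrable (lebesgue_on \<Omega>) (\<lambda>z. (norm (u z))\<^sup>2)}"

definition weak_gradient :: "'a::euclidean_space set \<Rightarrow> ('a \<Rightarrow> real) \<Rightarrow> ('a \<Rightarrow> 'a) \<Rightarrow> bool" where
  "weak_gradient \<Omega> u g \<longleftrightarrow> (\<forall>f \<in> test_functions \<Omega>. \<forall>b \<in> Basis.
     integral\<^sup>L (lebesgue_on \<Omega>) (\<lambda>z. u z * frechet_derivative f (at z) b) =
     - integral\<^sup>L (lebesgue_on \<Omega>) (\<lambda>z. (g z \<bullet> b) * f z))"

definition H1 :: "'a::euclidean_space set \<Rightarrow> ('a \<Rightarrow> real) set" where
  "H1 \<Omega> = {u \<in> L2 \<Omega>. \<exists>g \<in> L2 \<Omega>. weak_gradient \<Omega> u g}"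

text \<open>The weak gradient is unique up to null sets, so the choice is immaterial for the norm.\<close>

definition H1_norm :: "'a::euclidean_space set \<Rightarrow> ('a \<Rightarrow> real) \<Rightarrow> real" where
  "H1_norm \<Omega> u =
     (let g = (SOME g. g \<in> L2 \<Omega> \<and> weak_gradient \<Omega> u g) in
      sqrt (integral\<^sup>L (lebesgue_on \<Omega>) (\<lambda>z. (u z)\<^sup>2) +
            integral\<^sup>L (lebesgue_on \<Omega>) (\<lambda>z. (norm (g z))\<^sup>2)))"

definition H10 :: "'a::euclidean_space set \<Rightarrow> ('a \<Rightarrow> real) set" where
  "H10 \<Omega> = {u \<in> H1 \<Omega>. \<exists>f. (\<forall>k::nat. f k \<in> test_functions \<Omega>) \<and>
     (\<lambda>k. H1_norm \<Omega> (\<lambda>z. u z - f k z)) \<longlonglongrightarrow> 0}"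

text \<open>
  Boundedness of the forms with respect to \<open>H1_norm\<close> forces them to respect equality almost
  everywhere on \<open>\<Omega>\<close>.
\<close>

definition bounded_functional_H10 :: "'a::euclidean_space set \<Rightarrow> (('a \<Rightarrow> real) \<Rightarrow> real) \<Rightarrow> bool" where
  "bounded_functional_H10 \<Omega> L \<longleftrightarrow>
     (\<forall>u \<in> H10 \<Omega>. \<forall>v \<in> H10 \<Omega>. L (\<lambda>z. u z + v z) = L u + L v) \<and>
     (\<forall>c. \<forall>u \<in> H10 \<Omega>. L (\<lambda>z. c * u z) = c * L u) \<and>
     (\<exists>M. \<forall>u \<in> H10 \<Omega>. \<bar>L u\<bar> \<le> M * H1_norm \<Omega> u)"

definition symmetric_continuous_bilinear_H10 ::
    "'a::euclidean_space set \<Rightarrow> (('a \<Rightarrow> real) \<Rightarrow> ('a \<Rightarrow> real) \<Rightarrow> real) \<Rightarrow> bool" where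
  "symmetric_continuous_bilinear_H10 \<Omega> a \<longleftrightarrow>
     (\<forall>u \<in> H10 \<Omega>. \<forall>v \<in> H10 \<Omega>. a u v = a v u) \<and>
     (\<forall>u \<in> H10 \<Omega>. \<forall>v \<in> H10 \<Omega>. \<forall>w \<in> H10 \<Omega>. a (\<lambda>z. u z + v z) w = a u w + a v w) \<and>
     (\<forall>c. \<forall>u \<in> H10 \<Omega>. \<forall>w \<in> H10 \<Omega>. a (\<lambda>z. c * u z) w = c * a u w) \<and>
     (\<exists>M. \<forall>u \<in> H10 \<Omega>. \<forall>v \<in> H10 \<Omega>. \<bar>a u v\<bar> \<le> M * H1_norm \<Omega> u * H1_norm \<Omega> v)"

definition coercive_H10 ::
    "'a::euclidean_space set \<Rightarrow> (('a \<Rightarrow> real) \<Rightarrow> ('a \<Rightarrow> real) \<Rightarrow> real) \<Rightarrow> bool" where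
  "coercive_H10 \<Omega> a \<longleftrightarrow> (\<exists>\<alpha>>0. \<forall>u \<in> H10 \<Omega>. a u u \<ge> \<alpha> * (H1_norm \<Omega> u)\<^sup>2)"

definition positive_semidefinite_H10 ::
    "'a::euclidean_space set \<Rightarrow> (('a \<Rightarrow> real) \<Rightarrow> ('a \<Rightarrow> real) \<Rightarrow> real) \<Rightarrow> bool" where
  "positive_semidefinite_H10 \<Omega> a \<longleftrightarrow> (\<forall>u \<in> H10 \<Omega>. a u u \<ge> 0)"

definition subspace_H10 :: "'a::euclidean_space set \<Rightarrow> ('a \<Rightarrow> real) set \<Rightarrow> bool" where
  "subspace_H10 \<Omega> X \<longleftrightarrow> X \<subseteq> H10 \<Omega> \<and> (\<lambda>z. 0) \<in> X \<and>
     (\<forall>u \<in> X. \<forall>v \<in> X. (\<lambda>z. u z + v z) \<in> X) \<and> (\<forall>c. \<forall>u \<in> X. (\<lambda>z. c * u z) \<in> X)"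

text \<open>Linear independence and spanning are understood for almost everywhere classes on \<open>\<Omega>\<close>.\<close>

definition basis_H10 ::
    "'a::euclidean_space set \<Rightarrow> ('a \<Rightarrow> real) set \<Rightarrow> ('m::finite \<Rightarrow> 'a \<Rightarrow> real) \<Rightarrow> bool" where
  "basis_H10 \<Omega> X \<phi> \<longleftrightarrow> (\<forall>i. \<phi> i \<in> X) \<and>
     (\<forall>c. (AE z in lebesgue_on \<Omega>. (\<Sum>i\<in>UNIV. c i * \<phi> i z) = 0) \<longrightarrow> (\<forall>i. c i = 0)) \<and>
     (\<forall>u \<in> X. \<exists>c. AE z in lebesgue_on \<Omega>. u z = (\<Sum>i\<in>UNIV. c i * \<phi> i z))"

definition form_matrix ::
    "(('a \<Rightarrow> real) \<Rightarrow> ('a \<Rightarrow> real) \<Rightarrow> real) \<Rightarrow> ('m::finite \<Rightarrow> 'a \<Rightarrow> real) \<Rightarrow> real^'m^'m" where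
  "form_matrix a \<phi> = (\<chi> i j. a (\<phi> i) (\<phi> j))"

definition load_vector ::
    "(('a \<Rightarrow> real) \<Rightarrow> real) \<Rightarrow> ('m::finite \<Rightarrow> 'a \<Rightarrow> real) \<Rightarrow> real^'m" where
  "load_vector L \<phi> = (\<chi> i. L (\<phi> i))"

definition param_matrix :: "real^'m^'m \<Rightarrow> real^'m^'m \<Rightarrow> real \<Rightarrow> real^'m::finite^'m" where
  "param_matrix A\<^sub>0 A\<^sub>1 y = A\<^sub>0 + y *\<^sub>R A\<^sub>1"

text \<open>
  The number \<open>k\<close> of columns of a basis matrix depends on the subspace (and may be \<open>0\<close>), so the
  matrix is given by its columns \<open>Q 0, \<dots>, Q (k - 1)\<close>. Row \<open>i\<close> of \<open>Q\<^sup>T A Q z = Q\<^sup>T b\<close> is then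
  \<open>Q i \<bullet> A (\<Sum>j<k. z j Q j) = Q i \<bullet> b\<close>.
\<close>

definition basis_matrix :: "(real^'m) set \<Rightarrow> nat \<Rightarrow> (nat \<Rightarrow> real^'m::finite) \<Rightarrow> bool" where
  "basis_matrix V k Q \<longleftrightarrow>
     inj_on Q {..<k} \<and> independent (Q ` {..<k}) \<and> span (Q ` {..<k}) = V"

definition subspace_solution ::
    "real^'m^'m \<Rightarrow> real^'m \<Rightarrow> (real^'m) set \<Rightarrow> real^'m::finite \<Rightarrow> bool" where
  "subspace_solution A b V u \<longleftrightarrow>
     (\<exists>k Q z. basis_matrix V k Q \<and> u = (\<Sum>j<k. z j *\<^sub>R Q j) \<and>
        (\<forall>i<k. Q i \<bullet> (A *v (\<Sum>j<k. z j *\<^sub>R Q j)) = Q i \<bullet> b))"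

definition energy_norm :: "real^'m^'m \<Rightarrow> real^'m::finite \<Rightarrow> real" where
  "energy_norm A z = sqrt (z \<bullet> (A *v z))"

text \<open>
  Both norms take values in \<open>ennreal\<close> and are infinite outside the respective function space,
  in particular for functions that are not measurable.
\<close>

definition L2_norm :: "real^'m^'m \<Rightarrow> (real \<Rightarrow> real^'m::finite) \<Rightarrow> ennreal" where
  "L2_norm A f =
     (let I = (\<integral>\<^sup>+ y. ennreal ((energy_norm A (f y))\<^sup>2) \<partial>lebesgue_on {-1<..<1}) in
      if f \<in> borel_measurable (lebesgue_on {-1<..<1}) \<and> I < \<infinity>
      then ennreal (sqrt (enn2real I)) else \<infinity>)"

definition Linf_norm :: "real^'m^'m \<Rightarrow> (real \<Rightarrow> real^'m::finite) \<Rightarrow> ennreal" where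
  "Linf_norm A f =
     e2ennreal (esssup (lebesgue_on {-1<..<1}) (\<lambda>y. ereal (energy_norm A (f y))))"

text \<open>Polynomials are identified with the polynomial functions they induce on \<open>[-1, 1]\<close>.\<close>

definition poly_space :: "nat \<Rightarrow> real poly set" where
  "poly_space n = {q. degree q \<le> n}"

definition vec_poly_space :: "nat \<Rightarrow> (real \<Rightarrow> real^'m::finite) set" where
  "vec_poly_space n = {(\<lambda>y. \<chi> i. poly (q i) y) |q. \<forall>i. q i \<in> poly_space n}"

definition discrete_form ::
    "nat \<Rightarrow> (nat \<Rightarrow> real) \<Rightarrow> (nat \<Rightarrow> real) \<Rightarrow> real poly \<Rightarrow> real poly \<Rightarrow> real" where
  "discrete_form N ys ws g f = (\<Sum>i=1..N. poly g (ys i) * poly f (ys i) * ws i)"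

definition inner_product_on :: "real poly set \<Rightarrow> (real poly \<Rightarrow> real poly \<Rightarrow> real) \<Rightarrow> bool" where
  "inner_product_on P D \<longleftrightarrow>
     (\<forall>g \<in> P. \<forall>f \<in> P. D g f = D f g) \<and>
     (\<forall>f \<in> P. \<forall>g \<in> P. \<forall>h \<in> P. D (f + g) h = D f h + D g h) \<and>
     (\<forall>c. \<forall>f \<in> P. \<forall>h \<in> P. D (smult c f) h = c * D f h) \<and>
     (\<forall>f \<in> P. f \<noteq> 0 \<longrightarrow> D f f > 0)"

definition quadrature_error :: "nat \<Rightarrow> nat \<Rightarrow> (nat \<Rightarrow> real) \<Rightarrow> (nat \<Rightarrow> real) \<Rightarrow> real" where
  "quadrature_error n N ys ws =
     (GREATEST v. \<exists>q \<in> poly_space n - {0}.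
        v = \<bar>(integral {-1..1} (\<lambda>y. (poly q y)\<^sup>2) - (\<Sum>i=1..N. (poly q (ys i))\<^sup>2 * ws i)) /
             integral {-1..1} (\<lambda>y. (poly q y)\<^sup>2)\<bar>)"

end

theory Submission
  imports Defs
begin

text \<open>
  Let \<open>p\<close> be the discrete least-squares projection of \<open>x\<close> onto the polynomials of degree at most \<open>n\<close>.
  Its value at each \<open>y\<close> is a linear combination of the snapshots, so it lies in \<open>V\<close>, and Cea's lemma for
  \<open>A y\<close> bounds \<open>x - xt\<close> by \<open>\<kappa>\<close> times \<open>x - p\<close>, pointwise in \<open>y\<close>. With a best uniform
  approximation \<open>q\<close> write \<open>x - p = (x - q) + (q - p)\<close>. The first term contributes the factor \<open>sqrt 2\<close>.
  The second is the projection of \<open>q - x\<close>: the definition of \<open>e\<close> bounds its \<open>L\<^sup>2\<close> norm by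
  \<open>1 / sqrt (1 - e)\<close> times its discrete norm, which is at most the discrete norm of \<open>q - x\<close>, hence at
  most \<open>sqrt 2\<close> times the uniform norm. This gives the constant \<open>sqrt (2 / (1 - e))\<close>, which is at most
  \<open>C\<^sub>s\<close>. Compactness arguments show that the maximum defining \<open>e\<close> and the minimum over \<open>q\<close> are
  attained, without which \<open>GREATEST\<close> and \<open>LEAST\<close> would be unspecified.
\<close>

section \<open>Positive semidefinite forms and the energy norm\<close>

text \<open>The quadratic polynomial \<open>B (v - t w) (v - t w)\<close> in \<open>t\<close> is
  nonnegative, and evaluating it at its minimiser gives the inequality. As \<open>B\<close> is only
  semidefinite, \<open>B w w = 0\<close> can occur; the polynomial is then affine in
  \<open>t\<close>, which forces \<open>B v w = 0\<close>.\<close>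

lemma bilinear_cauchy_schwarz:
  fixes B :: "'a::real_vector \<Rightarrow> 'a \<Rightarrow> real"
  assumes B: "bilinear B" and sym: "\<And>v w. B v w = B w v" and psd: "\<And>v. 0 \<le> B v v"
  shows "(B v w)\<^sup>2 \<le> B v v * B w w"
proof -
  have expand: "0 \<le> B v v - 2 * t * B v w + t\<^sup>2 * B w w" for t
  proof -
    have "0 \<le> B (v - t *\<^sub>R w) (v - t *\<^sub>R w)" by (rule psd)
    also have "\<dots> = B v v - 2 * t * B v w + t\<^sup>2 * B w w"
      using sym[of w v]
      by (simp add: bilinear_lsub[OF B] bilinear_rsub[OF B] bilinear_lmul[OF B] bilinear_rmul[OF B]
          power2_eq_square algebra_simps)
    finally show ?thesis .
  qed
  show ?thesis
  proof (cases "B w w = 0")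
    case True
    have "B v w = 0"
    proof (rule ccontr)
      assume "B v w \<noteq> 0"
      then show False
        \<comment> \<open>This \<open>t\<close> makes the affine function equal to -1.\<close>
        using expand[of "(B v v + 1) / (2 * B v w)"] True by (simp add: field_simps)
    qed
    then show ?thesis by (simp add: True)
  next
    case False
    then have pos: "B w w > 0" using psd[of w] by linarith
    have "0 \<le> B v v - (B v w)\<^sup>2 / B w w"
      using expand[of "B v w / B w w"] pos by (simp add: field_simps power2_eq_square)
    then show ?thesis using pos by (simp add: field_simps)
  qed
qed

text \<open>Lagrange reduction: completing one square kills one diagonal entry and creates none.\<close>

lemma bilinear_psd_sum_of_squares:
  fixes B :: "'a::euclidean_space \<Rightarrow> 'a \<Rightarrow> real"
  assumes "bilinear B" and "\<And>v w. B v w = B w v" and "\<And>v. 0 \<le> B v v"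
  shows "\<exists>ls. \<forall>v. B v v = (\<Sum>l\<leftarrow>ls. (l \<bullet> v)\<^sup>2)"
  using assms
proof (induction "card {e \<in> Basis. B e e \<noteq> 0}" arbitrary: B rule: less_induct)
  case less
  note B = less.prems(1) and sym = less.prems(2) and psd = less.prems(3)
  show ?case
  proof (cases "\<exists>e \<in> Basis. B e e \<noteq> 0")
    case False
    have "B v v = 0" for v
    proof -
      \<comment> \<open>A vanishing diagonal entry kills its whole row by Cauchy-Schwarz, so a form
        with zero diagonal is zero.\<close>
      have zero: "B v e = 0" if "e \<in> Basis" for e
        using bilinear_cauchy_schwarz[OF B sym psd, of v e] False that by auto
      have "linear (B v)" using B by (auto simp: bilinear_def)
      moreover have "v = (\<Sum>e\<in>Basis. (v \<bullet> e) *\<^sub>R e)"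
        by (simp add: euclidean_representation)
      ultimately have "B v v = (\<Sum>e\<in>Basis. (v \<bullet> e) *\<^sub>R B v e)"
        by (metis (no_types, lifting) linear_sum linear_cmul sum.cong)
      then show ?thesis by (simp add: zero)
    qed
    then show ?thesis by (intro exI[of _ "[]"]) simp
  next
    case True
    then obtain e where e: "e \<in> Basis" "B e e \<noteq> 0" by blast
    then have pos: "B e e > 0" using psd[of e] by linarith
    \<comment> \<open>The Schur complement with respect to \<open>e\<close>: what remains of
      \<open>B\<close> after splitting off the square of \<open>B v e / sqrt (B e e)\<close>.
      Cauchy-Schwarz keeps it semidefinite.\<close>
    define B' where "B' v w = B v w - B v e * B w e / B e e" for v w
    have B': "bilinear B'"
      unfolding bilinear_def B'_def
      by (auto intro!: linearI simp: bilinear_ladd[OF B] bilinear_radd[OF B] bilinear_lmul[OF B]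
          bilinear_rmul[OF B] add_divide_distrib algebra_simps)
    have sym': "B' v w = B' w v" for v w
      using sym[of v w] by (simp add: B'_def)
    have psd': "0 \<le> B' v v" for v
      using bilinear_cauchy_schwarz[OF B sym psd, of v e] pos
      by (simp add: B'_def field_simps power2_eq_square)
    have "{f \<in> Basis. B' f f \<noteq> 0} \<subset> {f \<in> Basis. B f f \<noteq> 0}"
    proof
      show "{f \<in> Basis. B' f f \<noteq> 0} \<subseteq> {f \<in> Basis. B f f \<noteq> 0}"
      proof clarsimp
        fix f assume "B f f = 0" "B' f f \<noteq> 0"
        then show False
          using bilinear_cauchy_schwarz[OF B sym psd, of f e] by (auto simp: B'_def)
      qed
      show "{f \<in> Basis. B' f f \<noteq> 0} \<noteq> {f \<in> Basis. B f f \<noteq> 0}"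
      proof -
        have "e \<notin> {f \<in> Basis. B' f f \<noteq> 0}" using pos by (simp add: B'_def)
        then show ?thesis using e by blast
      qed
    qed
    then have "card {f \<in> Basis. B' f f \<noteq> 0} < card {f \<in> Basis. B f f \<noteq> 0}"
      by (intro psubset_card_mono) auto
    from less.hyps[OF this B' sym' psd'] obtain ls where
      ls: "\<And>v. B' v v = (\<Sum>l\<leftarrow>ls. (l \<bullet> v)\<^sup>2)" by blast
    have "linear (\<lambda>v. B v e)" using B by (auto simp: bilinear_def)
    then have adj: "adjoint (\<lambda>v. B v e) 1 \<bullet> v = B v e" for v
      using adjoint_works[of "\<lambda>v. B v e" v 1] by (simp add: inner_commute)
    \<comment> \<open>The Riesz vector of \<open>B v e\<close> as a functional of \<open>v\<close>,
      scaled so that its square is the part removed from \<open>B\<close>.\<close>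
    define l where "l = (1 / sqrt (B e e)) *\<^sub>R adjoint (\<lambda>v. B v e) 1"
    have "B v v = (\<Sum>l\<leftarrow>l # ls. (l \<bullet> v)\<^sup>2)" for v
    proof -
      have "(l \<bullet> v)\<^sup>2 = B v e * B v e / B e e"
        using pos by (simp add: l_def adj power_divide power2_eq_square)
      then show ?thesis using ls[of v] by (simp add: B'_def)
    qed
    then show ?thesis by blast
  qed
qed

text \<open>Tychonoff's theorem. Coefficient families are functions on the whole index type, pinned
  to 0 outside \<open>I\<close>, so that index sets given as terms, such as \<open>{..n}\<close>,
  can be used.\<close>

lemma compact_box_fun:
  fixes I :: "'i set" and R :: real
  shows "compact {c::'i \<Rightarrow> 'a::euclidean_space. (\<forall>i\<in>I. norm (c i) \<le> R) \<and> (\<forall>i. i \<notin> I \<longrightarrow> c i = 0)}"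
proof -
  have "compactin (product_topology (\<lambda>i. euclidean) UNIV)
      (PiE UNIV (\<lambda>i::'i. if i \<in> I then cball (0::'a) R else {0}))"
    unfolding compactin_PiE by (simp add: compactin_euclidean_iff)
  then have "compact (PiE UNIV (\<lambda>i::'i. if i \<in> I then cball (0::'a) R else {0}))"
    by (simp add: euclidean_product_topology)
  also have "PiE UNIV (\<lambda>i::'i. if i \<in> I then cball (0::'a) R else {0}) =
      {c. (\<forall>i\<in>I. norm (c i) \<le> R) \<and> (\<forall>i. i \<notin> I \<longrightarrow> c i = 0)}"
    by (auto simp: PiE_UNIV_domain Pi_iff split: if_splits)
  finally show ?thesis .
qed

section \<open>Energy norm of a symmetric positive definite matrix\<close>

lemma bilinear_matrix: "bilinear (\<lambda>v w. v \<bullet> (A *v w))" for A :: "real^'m^'m"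
  unfolding bilinear_def
  by (auto intro!: linearI simp: inner_add_left inner_add_right matrix_vector_right_distrib
      matrix_vector_mult_scaleR)

lemma continuous_on_energy_norm [continuous_intros]:
  fixes A :: "real^'m^'m"
  assumes "continuous_on S f"
  shows "continuous_on S (\<lambda>y. energy_norm A (f y))"
proof -
  have "continuous_on S (\<lambda>y. A *v f y)"
    using bounded_linear.continuous_on[OF matrix_vector_mul_bounded_linear assms] .
  then show ?thesis unfolding energy_norm_def using assms by (intro continuous_intros)
qed

locale spd_matrix =
  fixes A :: "real^'m^'m"
  assumes sym: "\<And>v w. v \<bullet> (A *v w) = w \<bullet> (A *v v)"
    and pos: "\<And>v. v \<noteq> 0 \<Longrightarrow> 0 < v \<bullet> (A *v v)"
begin

lemma nonneg: "0 \<le> v \<bullet> (A *v v)"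
  using pos[of v] by (cases "v = 0") auto

lemma energy_norm_nonneg: "0 \<le> energy_norm A v"
  by (simp add: energy_norm_def nonneg)

lemma energy_norm_sq: "(energy_norm A v)\<^sup>2 = v \<bullet> (A *v v)"
  by (simp add: energy_norm_def nonneg)

lemma energy_norm_minus_commute: "energy_norm A (v - w) = energy_norm A (w - v)"
proof -
  have "(v - w) \<bullet> (A *v (v - w)) = (w - v) \<bullet> (A *v (w - v))"
    by (simp add: matrix_vector_mult_diff_distrib inner_diff_left inner_diff_right)
  then show ?thesis by (simp add: energy_norm_def)
qed

lemma cauchy_schwarz: "v \<bullet> (A *v w) \<le> energy_norm A v * energy_norm A w"
proof -
  have "(v \<bullet> (A *v w))\<^sup>2 \<le> (energy_norm A v * energy_norm A w)\<^sup>2"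
    using bilinear_cauchy_schwarz[OF bilinear_matrix sym nonneg, of v w]
    by (simp add: power_mult_distrib energy_norm_sq)
  then show ?thesis
    by (rule power2_le_imp_le) (simp add: energy_norm_nonneg)
qed

lemma energy_norm_triangle: "energy_norm A (v + w) \<le> energy_norm A v + energy_norm A w"
proof (rule power2_le_imp_le)
  have "(energy_norm A (v + w))\<^sup>2 = v \<bullet> (A *v v) + 2 * (v \<bullet> (A *v w)) + w \<bullet> (A *v w)"
    using sym[of w v] by (simp add: energy_norm_sq matrix_vector_right_distrib inner_add_left inner_add_right)
  also have "\<dots> \<le> (energy_norm A v + energy_norm A w)\<^sup>2"
    using cauchy_schwarz[of v w] by (simp add: power2_sum energy_norm_sq)
  finally show "(energy_norm A (v + w))\<^sup>2 \<le> (energy_norm A v + energy_norm A w)\<^sup>2" .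
qed (simp add: energy_norm_nonneg add_nonneg_nonneg)

text \<open>The energy norm attains a positive minimum on the compact unit sphere; homogeneity
  extends the bound to all vectors.\<close>

lemma energy_norm_lower: obtains \<gamma> where "\<gamma> > 0" "\<And>v. \<gamma> * norm v \<le> energy_norm A v"
proof -
  obtain b :: "real^'m" where "b \<in> Basis" using nonempty_Basis by blast
  then have "sphere (0::real^'m) 1 \<noteq> {}" by (auto intro!: exI[of _ b])
  moreover have "continuous_on (sphere (0::real^'m) 1) (energy_norm A)"
    using continuous_on_energy_norm[OF continuous_on_id] by simp
  ultimately obtain u where u: "u \<in> sphere 0 1" "\<And>v. v \<in> sphere 0 1 \<Longrightarrow> energy_norm A u \<le> energy_norm A v"
    using continuous_attains_inf[OF compact_sphere] by metis
  have "u \<noteq> 0" using u by auto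
  then have "energy_norm A u > 0" by (simp add: energy_norm_def pos)
  moreover have "energy_norm A u * norm v \<le> energy_norm A v" for v
  proof (cases "v = 0")
    case False
    have "energy_norm A u \<le> energy_norm A ((1 / norm v) *\<^sub>R v)"
      using False by (intro u) simp
    also have "\<dots> = energy_norm A v / norm v"
      by (simp add: energy_norm_def matrix_vector_mult_scaleR real_sqrt_divide)
    finally show ?thesis using False by (simp add: field_simps)
  qed (simp add: energy_norm_def)
  ultimately show ?thesis using that by blast
qed

end

section \<open>Quadrature and discrete least squares\<close>

text \<open>If the integral of this continuous nonnegative function were 0, then \<open>q\<close>
  would vanish on an infinite set.\<close>

lemma integral_poly_sq_pos:
  fixes q :: "real poly"
  assumes "q \<noteq> 0"
  shows "0 < integral {-1..1} (\<lambda>y. (poly q y)\<^sup>2)"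
proof -
  have cont: "continuous_on {-1..1::real} (\<lambda>y. (poly q y)\<^sup>2)"
    by (intro continuous_intros)
  have "integral {-1..1} (\<lambda>y. (poly q y)\<^sup>2) \<noteq> 0"
  proof
    assume "integral {-1..1} (\<lambda>y. (poly q y)\<^sup>2) = 0"
    then have "\<forall>y\<in>{-1..1::real}. (poly q y)\<^sup>2 = 0"
      using integral_eq_0_iff[OF cont] by simp
    then have "{-1..1::real} \<subseteq> {y. poly q y = 0}" by auto
    then show False
      using finite_subset[OF _ poly_roots_finite[OF assms]] infinite_Icc[of "-1::real" 1] by simp
  qed
  moreover have "0 \<le> integral {-1..1} (\<lambda>y. (poly q y)\<^sup>2)"
    by (intro integral_nonneg integrable_continuous_real cont) auto
  ultimately show ?thesis by linarith
qed

text \<open>The ratio is homogeneous of degree \<open>0\<close>, so its supremum is attained on the compact unit sphere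
  of the coefficient space.\<close>

lemma quadrature_error_upper:
  assumes "q \<in> poly_space n - {0}"
  shows "\<bar>(integral {-1..1} (\<lambda>y. (poly q y)\<^sup>2) - (\<Sum>i=1..N. (poly q (ys i))\<^sup>2 * ws i)) /
      integral {-1..1} (\<lambda>y. (poly q y)\<^sup>2)\<bar> \<le> quadrature_error n N ys ws"
proof -
  define J where "J q = integral {-1..1} (\<lambda>y. (poly q y)\<^sup>2)" for q :: "real poly"
  define D where "D q = (\<Sum>i=1..N. (poly q (ys i))\<^sup>2 * ws i)" for q
  define E where "E q = \<bar>(J q - D q) / J q\<bar>" for q
  define P where "P c = (\<Sum>i\<le>n. monom (c i) i)" for c :: "nat \<Rightarrow> real"
  \<comment> \<open>Unit sphere of the coefficient space. The box bound is implied by the second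
    condition, but puts the set inside a compact product.\<close>
  define K where "K = {c::nat \<Rightarrow> real. (\<forall>i\<in>{..n}. norm (c i) \<le> 1) \<and> (\<forall>i. i \<notin> {..n} \<longrightarrow> c i = 0)} \<inter>
      {c. (\<Sum>i\<le>n. (c i)\<^sup>2) = 1}"
  have coeff_P: "coeff (P c) i = (if i \<le> n then c i else 0)" for c i
    by (simp add: P_def coeff_sum)
  have poly_P: "poly (P c) y = (\<Sum>i\<le>n. c i * y ^ i)" for c y
    by (simp add: P_def poly_sum poly_monom)
  have P_space: "P c \<in> poly_space n" for c
    by (auto simp: poly_space_def coeff_P intro!: degree_le)
  have P_nz: "P c \<noteq> 0" if "c \<in> K" for c
  proof
    assume "P c = 0"
    then have "c i = 0" if "i \<le> n" for i using coeff_P[of c i] that by simp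
    then show False using \<open>c \<in> K\<close> by (simp add: K_def)
  qed
  \<comment> \<open>Written as a quadratic form in the coefficients, \<open>J\<close> is visibly
    continuous in them.\<close>
  have J_P: "J (P c) = (\<Sum>i\<le>n. \<Sum>j\<le>n. c i * c j * integral {-1..1} (\<lambda>y. y ^ i * y ^ j))" for c
  proof -
    have int: "(\<lambda>y::real. c i * c j * (y ^ i * y ^ j)) integrable_on {-1..1}" for i j
      by (intro integrable_continuous_real continuous_intros)
    have "J (P c) = integral {-1..1} (\<lambda>y. \<Sum>i\<le>n. \<Sum>j\<le>n. c i * c j * (y ^ i * y ^ j))"
      by (simp add: J_def poly_P power2_eq_square sum_product mult_ac)
    also have "\<dots> = (\<Sum>i\<le>n. \<Sum>j\<le>n. integral {-1..1} (\<lambda>y. c i * c j * (y ^ i * y ^ j)))"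
      using int by (simp add: integral_sum integrable_sum)
    finally show ?thesis by simp
  qed
  have coord: "continuous_on K (\<lambda>c. c i)" for i :: nat
    by (rule continuous_on_subset[OF continuous_on_product_coordinates]) simp
  have "compact K"
    unfolding K_def
    by (intro compact_Int_closed compact_box_fun closed_Collect_eq continuous_intros
        continuous_on_product_coordinates)
  moreover have "K \<noteq> {}"
  proof -
    have "(\<lambda>i. if i = 0 then 1 else 0) \<in> K"
      by (auto simp: K_def power2_eq_square if_distrib cong: if_cong)
    then show ?thesis by blast
  qed
  moreover have "continuous_on K (\<lambda>c. E (P c))"
  proof -
    have "continuous_on K (\<lambda>c. J (P c))" "continuous_on K (\<lambda>c. D (P c))"
      unfolding J_P unfolding D_def poly_P by (intro continuous_intros coord)+
    moreover have "J (P c) \<noteq> 0" if "c \<in> K" for c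
      using integral_poly_sq_pos[OF P_nz[OF that]] by (simp add: J_def)
    ultimately show ?thesis unfolding E_def by (intro continuous_intros) auto
  qed
  ultimately obtain c0 where c0: "c0 \<in> K" "\<And>c. c \<in> K \<Longrightarrow> E (P c) \<le> E (P c0)"
    using continuous_attains_sup[of K "\<lambda>c. E (P c)"] by blast
  have max: "E p \<le> E (P c0)" if p: "p \<in> poly_space n - {0}" for p
  proof -
    have deg: "degree p \<le> n" and "p \<noteq> 0" using p by (auto simp: poly_space_def)
    define s where "s = (\<Sum>i\<le>n. (coeff p i)\<^sup>2)"
    have "s > 0"
      unfolding s_def
      by (rule sum_pos2[of _ "degree p"]) (use deg \<open>p \<noteq> 0\<close> in auto)
    \<comment> \<open>Normalising the coefficients moves \<open>p\<close> to the sphere without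
      changing the ratio \<open>E\<close>.\<close>
    define c where "c i = coeff p i / sqrt s" for i
    have c_sq: "(c i)\<^sup>2 = (coeff p i)\<^sup>2 / s" for i
      using \<open>s > 0\<close> by (simp add: c_def power_divide)
    have c_sum: "(\<Sum>i\<le>n. (c i)\<^sup>2) = 1"
      using \<open>s > 0\<close> by (simp add: c_sq s_def flip: sum_divide_distrib)
    have "norm (c i) \<le> 1" if "i \<le> n" for i
    proof -
      have "(c i)\<^sup>2 \<le> (\<Sum>i\<le>n. (c i)\<^sup>2)"
        by (rule member_le_sum) (use that in auto)
      then show ?thesis by (simp add: c_sum abs_square_le_1)
    qed
    moreover have "c i = 0" if "\<not> i \<le> n" for i
      using that deg by (simp add: c_def coeff_eq_0)
    ultimately have "c \<in> K" by (simp add: K_def c_sum)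
    moreover have P_c: "P c = smult (1 / sqrt s) p"
      by (rule poly_eqI) (use deg in \<open>auto simp: coeff_P c_def coeff_eq_0\<close>)
    have "J (P c) = J p / s" "D (P c) = D p / s"
      using \<open>s > 0\<close>
      by (simp_all add: P_c J_def D_def power_mult_distrib power_divide flip: sum_divide_distrib)
    then have "E (P c) = E p"
      using \<open>s > 0\<close> by (simp add: E_def flip: diff_divide_distrib)
    ultimately show ?thesis using c0(2)[of c] by simp
  qed
  have "quadrature_error n N ys ws = E (P c0)"
    unfolding quadrature_error_def
  proof (rule Greatest_equality)
    show "\<exists>q\<in>poly_space n - {0}. E (P c0) =
      \<bar>(integral {-1..1} (\<lambda>y. (poly q y)\<^sup>2) - (\<Sum>i=1..N. (poly q (ys i))\<^sup>2 * ws i)) /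
         integral {-1..1} (\<lambda>y. (poly q y)\<^sup>2)\<bar>"
      using P_space P_nz[OF c0(1)] by (intro bexI[of _ "P c0"]) (auto simp: E_def J_def D_def)
  qed (use max in \<open>auto simp: E_def J_def D_def\<close>)
  then show ?thesis using max[OF assms] by (simp add: E_def J_def D_def)
qed

text \<open>Only one side of the absolute value defining the quadrature error is used: the integral
  must not exceed the discrete sum by too much.\<close>

lemma integral_le_discrete:
  assumes "degree q \<le> n"
  shows "(1 - quadrature_error n N ys ws) * integral {-1..1} (\<lambda>y. (poly q y)\<^sup>2) \<le>
    (\<Sum>i=1..N. (poly q (ys i))\<^sup>2 * ws i)"
proof (cases "q = 0")
  case False
  let ?J = "integral {-1..1} (\<lambda>y. (poly q y)\<^sup>2)"
  let ?D = "\<Sum>i=1..N. (poly q (ys i))\<^sup>2 * ws i"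
  have "?J > 0" using integral_poly_sq_pos[OF False] .
  have "(?J - ?D) / ?J \<le> quadrature_error n N ys ws"
    by (rule abs_le_D1[OF quadrature_error_upper]) (use assms False in \<open>simp add: poly_space_def\<close>)
  then have "?J - ?D \<le> quadrature_error n N ys ws * ?J"
    using \<open>?J > 0\<close> by (simp add: divide_le_eq)
  then show ?thesis by (simp add: algebra_simps)
qed simp

text \<open>Gram--Schmidt, adding one monomial at a time. The coefficient condition says
  \<open>degree p < k\<close>, but admits \<open>k = 0\<close>.\<close>

lemma discrete_projection_exists:
  fixes ys ws g :: "nat \<Rightarrow> real"
  assumes pos: "\<And>f. degree f \<le> n \<Longrightarrow> f \<noteq> 0 \<Longrightarrow> 0 < (\<Sum>i=1..N. (poly f (ys i))\<^sup>2 * ws i)"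
    and "k \<le> Suc n"
  shows "\<exists>p. (\<forall>j\<ge>k. coeff p j = 0) \<and> (\<forall>q. (\<forall>j\<ge>k. coeff q j = 0) \<longrightarrow>
    (\<Sum>i=1..N. (g i - poly p (ys i)) * poly q (ys i) * ws i) = 0)"
  using assms(2)
proof (induction k arbitrary: g)
  case 0
  have "(\<forall>j. coeff q j = 0) \<longleftrightarrow> q = 0" for q :: "real poly"
    by (simp add: poly_eq_iff)
  then show ?case by simp
next
  case (Suc k)
  then have "k \<le> Suc n" by simp
  from Suc.IH[OF this, of "\<lambda>i. ys i ^ k"] obtain pm where
    pm: "\<forall>j\<ge>k. coeff pm j = 0" "\<And>q. \<forall>j\<ge>k. coeff q j = 0 \<Longrightarrow>
      (\<Sum>i=1..N. (ys i ^ k - poly pm (ys i)) * poly q (ys i) * ws i) = 0" by blast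
  from Suc.IH[OF \<open>k \<le> Suc n\<close>, of g] obtain p where
    p: "\<forall>j\<ge>k. coeff p j = 0" "\<And>q. \<forall>j\<ge>k. coeff q j = 0 \<Longrightarrow>
      (\<Sum>i=1..N. (g i - poly p (ys i)) * poly q (ys i) * ws i) = 0" by blast
  \<comment> \<open>The next orthogonal polynomial: the monomial of degree \<open>k\<close> minus
    its projection onto lower degrees. It is monic, hence nonzero.\<close>
  define \<psi> where "\<psi> = monom 1 k - pm"
  have orth: "(\<Sum>i=1..N. poly \<psi> (ys i) * poly q (ys i) * ws i) = 0" if "\<forall>j\<ge>k. coeff q j = 0" for q
    using pm(2)[OF that] by (simp add: \<psi>_def poly_monom)
  have coeff_\<psi>: "coeff \<psi> k = 1" "\<forall>j\<ge>Suc k. coeff \<psi> j = 0"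
    using pm(1) by (auto simp: \<psi>_def)
  have "degree \<psi> \<le> n"
    using coeff_\<psi>(2) Suc.prems by (intro degree_le) auto
  moreover have "\<psi> \<noteq> 0" using coeff_\<psi>(1) by auto
  ultimately have D: "0 < (\<Sum>i=1..N. (poly \<psi> (ys i))\<^sup>2 * ws i)" (is "0 < ?D") by (rule pos)
  \<comment> \<open>The Fourier coefficient of the data \<open>g\<close> with respect to
    \<open>\<psi>\<close>.\<close>
  define \<alpha> where "\<alpha> = (\<Sum>i=1..N. g i * poly \<psi> (ys i) * ws i) / ?D"
  show ?case
  proof (intro exI[of _ "p + smult \<alpha> \<psi>"] conjI allI impI)
    fix j assume "Suc k \<le> j"
    then show "coeff (p + smult \<alpha> \<psi>) j = 0" using p(1) coeff_\<psi>(2) by simp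
  next
    fix q :: "real poly" assume q: "\<forall>j\<ge>Suc k. coeff q j = 0"
    \<comment> \<open>As \<open>\<psi>\<close> is monic, this removes the term of degree
      \<open>k\<close>. Orthogonality then has to be tested only against lower degrees and against
      \<open>\<psi>\<close> itself.\<close>
    define q' where "q' = q - smult (coeff q k) \<psi>"
    have q': "\<forall>j\<ge>k. coeff q' j = 0"
    proof clarify
      fix j assume "k \<le> j"
      then show "coeff q' j = 0"
        using q coeff_\<psi> by (cases "j = k") (auto simp: q'_def)
    qed
    have q_eq: "poly q y = poly q' y + coeff q k * poly \<psi> y" for y
      by (simp add: q'_def)
    have sum1: "(\<Sum>i=1..N. (g i - poly (p + smult \<alpha> \<psi>) (ys i)) * poly q' (ys i) * ws i) = 0"
    proof -
      have "(\<Sum>i=1..N. (g i - poly (p + smult \<alpha> \<psi>) (ys i)) * poly q' (ys i) * ws i) =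
        (\<Sum>i=1..N. (g i - poly p (ys i)) * poly q' (ys i) * ws i) -
        \<alpha> * (\<Sum>i=1..N. poly \<psi> (ys i) * poly q' (ys i) * ws i)"
        by (simp add: sum_distrib_left algebra_simps flip: sum_subtractf sum.distrib)
      then show ?thesis using p(2)[OF q'] orth[OF q'] by simp
    qed
    have sum2: "(\<Sum>i=1..N. (g i - poly (p + smult \<alpha> \<psi>) (ys i)) * poly \<psi> (ys i) * ws i) = 0"
    proof -
      have "(\<Sum>i=1..N. (g i - poly (p + smult \<alpha> \<psi>) (ys i)) * poly \<psi> (ys i) * ws i) =
        (\<Sum>i=1..N. g i * poly \<psi> (ys i) * ws i) - (\<Sum>i=1..N. poly \<psi> (ys i) * poly p (ys i) * ws i) -
        \<alpha> * ?D"
        by (simp add: sum_distrib_left power2_eq_square algebra_simps flip: sum_subtractf sum.distrib)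
      then show ?thesis using orth[OF p(1)] D by (simp add: \<alpha>_def)
    qed
    have "(\<Sum>i=1..N. (g i - poly (p + smult \<alpha> \<psi>) (ys i)) * poly q (ys i) * ws i) =
      (\<Sum>i=1..N. (g i - poly (p + smult \<alpha> \<psi>) (ys i)) * poly q' (ys i) * ws i) +
      coeff q k * (\<Sum>i=1..N. (g i - poly (p + smult \<alpha> \<psi>) (ys i)) * poly \<psi> (ys i) * ws i)"
      unfolding sum_distrib_left sum.distrib[symmetric] q_eq
      by (rule sum.cong) (simp_all add: algebra_simps)
    then show "(\<Sum>i=1..N. (g i - poly (p + smult \<alpha> \<psi>) (ys i)) * poly q (ys i) * ws i) = 0"
      using sum1 sum2 by simp
  qed
qed

text \<open>The polynomial \<open>l i\<close> is the least-squares fit to the data \<open>1\<close> at node \<open>i\<close> and \<open>0\<close> at the other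
  nodes, so \<open>\<Sum>i. g i * l i\<close> is the fit to \<open>g\<close>.\<close>

lemma least_squares_basis:
  fixes ys ws :: "nat \<Rightarrow> real"
  assumes pos: "\<And>f. degree f \<le> n \<Longrightarrow> f \<noteq> 0 \<Longrightarrow> 0 < (\<Sum>i=1..N. (poly f (ys i))\<^sup>2 * ws i)"
    and ws: "\<And>i. i \<in> {1..N} \<Longrightarrow> 0 < ws i"
  obtains l where "\<And>i. degree (l i) \<le> n"
    and "\<And>q y. degree q \<le> n \<Longrightarrow> poly q y = (\<Sum>i=1..N. poly q (ys i) * poly (l i) y)"
    and "\<And>g. (\<Sum>k=1..N. (\<Sum>i=1..N. g i * poly (l i) (ys k))\<^sup>2 * ws k) \<le> (\<Sum>k=1..N. (g k)\<^sup>2 * ws k)"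
proof -
  have deg_iff: "(\<forall>j\<ge>Suc n. coeff q j = 0) \<longleftrightarrow> degree q \<le> n" for q :: "real poly"
    by (metis Suc_le_eq coeff_eq_0 degree_le le_less_trans)
  have "\<forall>i. \<exists>p. degree p \<le> n \<and> (\<forall>q. degree q \<le> n \<longrightarrow>
      (\<Sum>k=1..N. ((if k = i then 1 else 0) - poly p (ys k)) * poly q (ys k) * ws k) = 0)"
    using discrete_projection_exists[of n ys ws N "Suc n", OF pos] unfolding deg_iff by simp
  then obtain l where deg: "\<And>i. degree (l i) \<le> n"
    and l: "\<And>i q. degree q \<le> n \<Longrightarrow>
      (\<Sum>k=1..N. ((if k = i then 1 else 0) - poly (l i) (ys k)) * poly q (ys k) * ws k) = 0"
    by metis
  define fit where "fit g = (\<Sum>i=1..N. smult (g i) (l i))" for g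
  have poly_fit: "poly (fit g) y = (\<Sum>i=1..N. g i * poly (l i) y)" for g y
    by (simp add: fit_def poly_sum)
  have deg_fit: "degree (fit g) \<le> n" for g
    unfolding fit_def by (intro degree_sum_le) (auto simp: deg)
  have orth: "(\<Sum>k=1..N. (g k - poly (fit g) (ys k)) * poly q (ys k) * ws k) = 0"
    if "degree q \<le> n" for g q
  proof -
    have "g k - poly (fit g) (ys k) = (\<Sum>i=1..N. g i * ((if k = i then 1 else 0) - poly (l i) (ys k)))"
      if "k \<in> {1..N}" for k
      using that by (simp add: poly_fit right_diff_distrib sum_subtractf mult_delta_right)
    then have "(\<Sum>k=1..N. (g k - poly (fit g) (ys k)) * poly q (ys k) * ws k) =
      (\<Sum>k=1..N. \<Sum>i=1..N. g i * (((if k = i then 1 else 0) - poly (l i) (ys k)) * poly q (ys k) * ws k))"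
      by (intro sum.cong refl) (simp add: sum_distrib_right mult.assoc)
    also have "\<dots> = (\<Sum>i=1..N. g i *
      (\<Sum>k=1..N. ((if k = i then 1 else 0) - poly (l i) (ys k)) * poly q (ys k) * ws k))"
      by (subst sum.swap) (simp add: sum_distrib_left)
    finally show ?thesis using l[OF that] by simp
  qed
  show ?thesis
  proof
    show "degree (l i) \<le> n" for i by (rule deg)
    show "poly q y = (\<Sum>i=1..N. poly q (ys i) * poly (l i) y)" if "degree q \<le> n" for q y
    proof -
      \<comment> \<open>The residual of a polynomial under its own fit is again a polynomial of
        degree at most \<open>n\<close>, hence orthogonal to itself, hence 0 by
        definiteness.\<close>
      define d where "d = q - fit (\<lambda>i. poly q (ys i))"
      have "degree d \<le> n" unfolding d_def by (intro degree_diff_le that deg_fit)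
      from orth[OF this, of "\<lambda>i. poly q (ys i)"]
      have "(\<Sum>k=1..N. (poly d (ys k))\<^sup>2 * ws k) = 0"
        by (simp add: d_def power2_eq_square)
      then have "d = 0" using pos[OF \<open>degree d \<le> n\<close>] by auto
      then have "q = fit (\<lambda>i. poly q (ys i))" by (simp add: d_def)
      then have "poly q y = poly (fit (\<lambda>i. poly q (ys i))) y" by (rule arg_cong)
      then show ?thesis by (simp only: poly_fit)
    qed
    show "(\<Sum>k=1..N. (\<Sum>i=1..N. g i * poly (l i) (ys k))\<^sup>2 * ws k) \<le> (\<Sum>k=1..N. (g k)\<^sup>2 * ws k)" for g
    proof -
      \<comment> \<open>Pythagoras: the mixed term vanishes because the residual is orthogonal to
        the fit.\<close>
      have "(\<Sum>k=1..N. (g k)\<^sup>2 * ws k) - (\<Sum>k=1..N. (poly (fit g) (ys k))\<^sup>2 * ws k) =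
        (\<Sum>k=1..N. (g k - poly (fit g) (ys k))\<^sup>2 * ws k) +
        2 * (\<Sum>k=1..N. (g k - poly (fit g) (ys k)) * poly (fit g) (ys k) * ws k)"
        unfolding sum_distrib_left sum.distrib[symmetric] sum_subtractf[symmetric]
        by (rule sum.cong) (simp_all add: power2_eq_square algebra_simps)
      also have "\<dots> \<ge> 0"
        using orth[OF deg_fit] ws by (auto intro!: sum_nonneg mult_nonneg_nonneg simp: less_imp_le)
      finally show ?thesis by (simp add: poly_fit)
    qed
  qed
qed

section \<open>Best uniform approximation\<close>

context spd_matrix
begin

text \<open>For continuous \<open>f\<close> the essential supremum is a supremum: the set where the
  energy norm exceeds \<open>v\<close> is open, and a nonempty open set is not null.\<close>

lemma Linf_norm_le_iff:
  assumes f: "continuous_on {-1<..<1} f" and "0 \<le> v"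
  shows "Linf_norm A f \<le> ennreal v \<longleftrightarrow> (\<forall>y\<in>{-1<..<1}. energy_norm A (f y) \<le> v)"
proof -
  let ?S = "{-1<..<1::real}"
  let ?M = "lebesgue_on ?S"
  let ?g = "\<lambda>y. energy_norm A (f y)"
  have g: "continuous_on ?S ?g" by (intro continuous_intros f)
  have meas: "(\<lambda>y. ereal (?g y)) \<in> borel_measurable ?M"
    by (intro borel_measurable_ereal continuous_imp_measurable_on_sets_lebesgue g) auto
  have "Linf_norm A f \<le> ennreal v \<longleftrightarrow> esssup ?M (\<lambda>y. ereal (?g y)) \<le> ereal v"
  proof
    assume le: "Linf_norm A f \<le> ennreal v"
    \<comment> \<open>\<open>e2ennreal\<close> truncates negative values to 0, so the sign of the
      essential supremum has to be distinguished.\<close>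
    show "esssup ?M (\<lambda>y. ereal (?g y)) \<le> ereal v"
    proof (cases "0 \<le> esssup ?M (\<lambda>y. ereal (?g y))")
      case True
      have "enn2ereal (Linf_norm A f) \<le> enn2ereal (ennreal v)"
        using le by (simp add: less_eq_ennreal.rep_eq)
      then show ?thesis
        using True \<open>0 \<le> v\<close> by (simp add: Linf_norm_def enn2ereal_e2ennreal)
    next
      case False
      then have "esssup ?M (\<lambda>y. ereal (?g y)) \<le> 0" by simp
      also have "0 \<le> ereal v" using \<open>0 \<le> v\<close> by simp
      finally show ?thesis .
    qed
  next
    assume "esssup ?M (\<lambda>y. ereal (?g y)) \<le> ereal v"
    then show "Linf_norm A f \<le> ennreal v"
      unfolding Linf_norm_def by (metis e2ennreal_mono e2ennreal_ereal)
  qed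
  also have "\<dots> \<longleftrightarrow> (AE y in ?M. ?g y \<le> v)"
  proof
    assume le: "esssup ?M (\<lambda>y. ereal (?g y)) \<le> ereal v"
    have "AE y in ?M. ereal (?g y) \<le> esssup ?M (\<lambda>y. ereal (?g y))" by (rule esssup_AE)
    then show "AE y in ?M. ?g y \<le> v"
    proof (rule eventually_mono)
      fix y assume "ereal (?g y) \<le> esssup ?M (\<lambda>y. ereal (?g y))"
      then have "ereal (?g y) \<le> ereal v" using le by (rule order_trans)
      then show "?g y \<le> v" by simp
    qed
  next
    assume "AE y in ?M. ?g y \<le> v"
    then show "esssup ?M (\<lambda>y. ereal (?g y)) \<le> ereal v"
      by (intro esssup_I meas) simp
  qed
  also have "\<dots> \<longleftrightarrow> (\<forall>y\<in>?S. ?g y \<le> v)"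
  proof
    assume "AE y in ?M. ?g y \<le> v"
    then have "AE y in lebesgue. y \<in> ?S \<longrightarrow> ?g y \<le> v"
      by (subst (asm) AE_restrict_space_iff) auto
    then obtain N where N: "N \<in> null_sets lebesgue" "{y. \<not> (y \<in> ?S \<longrightarrow> ?g y \<le> v)} \<subseteq> N"
      by (auto simp: eventually_ae_filter)
    show "\<forall>y\<in>?S. ?g y \<le> v"
    proof (rule ccontr)
      assume "\<not> ?thesis"
      then obtain y where y: "y \<in> ?S" "v < ?g y" by (auto simp: not_le)
      have "open {z \<in> ?S. ?g z \<in> {v<..}}"
        by (rule continuous_open_preimage[OF g, unfolded vimage_def Int_def, simplified mem_Collect_eq])
          auto
      moreover have "y \<in> {z \<in> ?S. ?g z \<in> {v<..}}" using y by simp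
      ultimately obtain d where "d > 0" "ball y d \<subseteq> {z \<in> ?S. ?g z \<in> {v<..}}"
        by (rule openE)
      then have "ball y d \<subseteq> N" using N(2) by (auto simp: not_le)
      moreover have "negligible N" using N(1) by (simp add: negligible_iff_null_sets)
      ultimately have "negligible (ball y d)" by (metis negligible_subset)
      moreover have "ball y d = box (y - d) (y + d)" by (simp add: ball_eq_greaterThanLessThan)
      ultimately have "box (y - d) (y + d) = {}" by (simp only: negligible_interval)
      then show False using \<open>d > 0\<close> by simp
    qed
  next
    assume "\<forall>y\<in>?S. ?g y \<le> v"
    then show "AE y in ?M. ?g y \<le> v" by (intro AE_I2) simp
  qed
  finally show ?thesis .
qed

text \<open>Elements of the finite-dimensional space are parametrised by their values at the nodes, so that
  the sublevel sets of the error are bounded.\<close>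

lemma best_approximation_exists:
  fixes x :: "real \<Rightarrow> real^'m" and l :: "'i \<Rightarrow> real \<Rightarrow> real" and I :: "'i set"
  assumes x: "continuous_on {-1<..<1} x" and "finite I"
    and t: "\<And>i. i \<in> I \<Longrightarrow> t i \<in> {-1<..<1}"
    and l: "\<And>i. i \<in> I \<Longrightarrow> continuous_on {-1<..<1} (l i)"
    and F: "\<And>c. (\<lambda>y. \<Sum>i\<in>I. l i y *\<^sub>R c i) \<in> F"
    and repr: "\<And>q y. q \<in> F \<Longrightarrow> q y = (\<Sum>i\<in>I. l i y *\<^sub>R q (t i))"
  obtains q where "q \<in> F" "\<And>p. p \<in> F \<Longrightarrow> Linf_norm A (\<lambda>y. x y - q y) \<le> Linf_norm A (\<lambda>y. x y - p y)"
proof -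
  define m where "m = (INF p\<in>F. Linf_norm A (\<lambda>y. x y - p y))"
  have cont: "continuous_on {-1<..<1} q" if "q \<in> F" for q
  proof -
    have "continuous_on {-1<..<1} (\<lambda>y. \<Sum>i\<in>I. l i y *\<^sub>R q (t i))"
      by (intro continuous_intros l)
    then show ?thesis by (rule continuous_on_eq) (rule repr[OF that, symmetric])
  qed
  show ?thesis
  proof (cases "m = top")
    \<comment> \<open>If every error is infinite, any element of \<open>F\<close> is a
      minimiser.\<close>
    case True
    then have "Linf_norm A (\<lambda>y. x y - p y) = top" if "p \<in> F" for p
      using that by (simp add: m_def INF_top_conv)
    then show ?thesis using that[OF F] by simp
  next
    case False
    then obtain \<mu> where \<mu>: "m = ennreal \<mu>" "0 \<le> \<mu>" by (cases m) auto
    define q where "q c y = (\<Sum>i\<in>I. l i y *\<^sub>R c i)" for c :: "'i \<Rightarrow> real^'m" and y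
    have q_F: "q c \<in> F" for c using F[of c] by (simp add: q_def[abs_def])
    obtain \<gamma> where \<gamma>: "\<gamma> > 0" "\<And>v. \<gamma> * norm v \<le> energy_norm A v" using energy_norm_lower by blast
    \<comment> \<open>Bounds the nodal values of every \<open>p\<close> whose error is at most
      \<open>\<mu> + 1\<close>: the second summand bounds the Euclidean distance of \<open>p\<close>
      to \<open>x\<close> at a node.\<close>
    define R where "R = (\<Sum>i\<in>I. norm (x (t i))) + (\<mu> + 1) / \<gamma>"
    define K where "K = {c. (\<forall>i\<in>I. norm (c i) \<le> R) \<and> (\<forall>i. i \<notin> I \<longrightarrow> c i = (0::real^'m))}"
    \<comment> \<open>Sublevel sets at levels decreasing to the infimum. Stated pointwise in
      \<open>y\<close>, the condition is an intersection of closed conditions on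
      \<open>c\<close>.\<close>
    define T where "T k = {c. \<forall>y\<in>{-1<..<1}. energy_norm A (x y - q c y) \<le> \<mu> + 1 / real (Suc k)}" for k
    have "K \<inter> (\<Inter>k\<in>UNIV. T k) \<noteq> {}"
    proof (rule compact_imp_fip_image)
      show "compact K" unfolding K_def by (rule compact_box_fun)
      show "closed (T k)" for k
        unfolding T_def q_def Ball_def
        by (intro closed_Collect_all closed_Collect_imp open_Collect_const closed_Collect_le
            continuous_intros continuous_on_product_coordinates)
      fix J :: "nat set" assume "finite J"
      \<comment> \<open>The sets \<open>T j\<close> shrink as \<open>j\<close> grows, so one
        near-minimiser for the largest index serves all of \<open>J\<close>. Inserting 0 gives
        \<open>Max\<close> a nonempty argument even for empty \<open>J\<close>.\<close>
      define k where "k = Max (insert 0 J)"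
      have "m < ennreal (\<mu> + 1 / real (Suc k))"
        using \<mu> by (simp add: ennreal_less_iff)
      then obtain p where p: "p \<in> F" "Linf_norm A (\<lambda>y. x y - p y) < ennreal (\<mu> + 1 / real (Suc k))"
        unfolding m_def INF_less_iff by blast
      have p_le: "energy_norm A (x y - p y) \<le> \<mu> + 1 / real (Suc k)" if "y \<in> {-1<..<1}" for y
        using Linf_norm_le_iff[of "\<lambda>y. x y - p y" "\<mu> + 1 / real (Suc k)"] p \<mu>(2) that
          continuous_on_diff[OF x cont[OF p(1)]] less_imp_le by force
      define c where "c i = (if i \<in> I then p (t i) else 0)" for i
      have q_c: "q c y = p y" for y
        using repr[OF p(1), of y] by (simp add: q_def c_def)
      have "norm (c i) \<le> R" if "i \<in> I" for i
      proof -
        have "\<gamma> * norm (x (t i) - p (t i)) \<le> \<mu> + 1 / real (Suc k)"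
          using \<gamma>(2) p_le[OF t[OF that]] by (rule order_trans)
        also have "\<dots> \<le> \<mu> + 1" by simp
        finally have "norm (x (t i) - p (t i)) \<le> (\<mu> + 1) / \<gamma>"
          using \<gamma>(1) by (simp add: field_simps)
        moreover have "norm (p (t i)) \<le> norm (x (t i)) + norm (x (t i) - p (t i))"
          using norm_triangle_ineq4[of "x (t i)" "x (t i) - p (t i)"] by simp
        moreover have "norm (x (t i)) \<le> (\<Sum>i\<in>I. norm (x (t i)))"
          by (rule member_le_sum) (use that \<open>finite I\<close> in auto)
        ultimately show ?thesis using that by (simp add: R_def c_def)
      qed
      then have "c \<in> K" by (simp add: K_def c_def)
      moreover have "c \<in> T j" if "j \<in> J" for j
      proof -
        have "j \<le> k" using that \<open>finite J\<close> by (simp add: k_def)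
        then have "1 / real (Suc k) \<le> 1 / real (Suc j)" by (simp add: frac_le)
        then have "energy_norm A (x y - q c y) \<le> \<mu> + 1 / real (Suc j)" if "y \<in> {-1<..<1}" for y
          using p_le[OF that] unfolding q_c by linarith
        then show ?thesis by (simp add: T_def)
      qed
      ultimately show "K \<inter> (\<Inter>j\<in>J. T j) \<noteq> {}" by blast
    qed
    then obtain c where c: "\<And>k. c \<in> T k" by blast
    have "energy_norm A (x y - q c y) \<le> \<mu>" if "y \<in> {-1<..<1}" for y
    proof (rule field_le_epsilon)
      fix \<epsilon> :: real assume "\<epsilon> > 0"
      then obtain k where "1 / real (Suc k) < \<epsilon>" using nat_approx_posE by metis
      moreover have "energy_norm A (x y - q c y) \<le> \<mu> + 1 / real (Suc k)"
        using c[of k] that unfolding T_def by blast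
      ultimately show "energy_norm A (x y - q c y) \<le> \<mu> + \<epsilon>" by linarith
    qed
    then have "Linf_norm A (\<lambda>y. x y - q c y) \<le> m"
      using Linf_norm_le_iff[of "\<lambda>y. x y - q c y" \<mu>] \<mu> continuous_on_diff[OF x cont[OF q_F]] by simp
    moreover have "m \<le> Linf_norm A (\<lambda>y. x y - p y)" if "p \<in> F" for p
      unfolding m_def using that by (rule INF_lower)
    ultimately show ?thesis using that[OF q_F] order_trans by blast
  qed
qed

end

section \<open>Galerkin solutions\<close>

text \<open>The equations for the columns of \<open>Q\<close> extend linearly to their span. This
  Galerkin characterisation no longer mentions the basis matrix.\<close>

lemma subspace_solution_orthogonal:
  assumes "subspace_solution A b V u"
  shows "u \<in> V" and "\<And>v. v \<in> V \<Longrightarrow> v \<bullet> (A *v u) = v \<bullet> b"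
proof -
  obtain k Q z where Q: "basis_matrix V k Q" and u: "u = (\<Sum>j<k. z j *\<^sub>R Q j)"
    and orth: "\<And>i. i < k \<Longrightarrow> Q i \<bullet> (A *v u) = Q i \<bullet> b"
    using assms unfolding subspace_solution_def by blast
  have V: "V = span (Q ` {..<k})" using Q by (simp add: basis_matrix_def)
  show "u \<in> V"
    unfolding u V by (intro span_sum span_scale span_base) auto
  fix v assume "v \<in> V"
  then have "v \<in> span (Q ` {..<k})" by (simp add: V)
  then show "v \<bullet> (A *v u) = v \<bullet> b"
    by (induction rule: span_induct_alt) (auto simp: inner_add_left orth)
qed

text \<open>Matrix counterpart of the model problem: the properties of the two forms, expressed for
  coefficient vectors.\<close>

locale parametric_spd = spd_matrix A\<^sub>0 for A\<^sub>0 :: "real^'m^'m" +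
  fixes A\<^sub>1 :: "real^'m^'m" and r C :: real
  assumes sym1: "\<And>v w. v \<bullet> (A\<^sub>1 *v w) = w \<bullet> (A\<^sub>1 *v v)"
    and psd1: "\<And>v. 0 \<le> v \<bullet> (A\<^sub>1 *v v)"
    and upper1: "\<And>v. v \<bullet> (A\<^sub>1 *v v) \<le> (1 - r) * (v \<bullet> (A\<^sub>0 *v v))"
    and bound1: "\<And>v w. \<bar>v \<bullet> (A\<^sub>1 *v w)\<bar> \<le> C * energy_norm A\<^sub>0 v * energy_norm A\<^sub>0 w"
    and r_pos: "0 < r" and C_pos: "0 < C"
begin

lemma inner_param_matrix:
  "v \<bullet> (param_matrix A\<^sub>0 A\<^sub>1 y *v w) = v \<bullet> (A\<^sub>0 *v w) + y * (v \<bullet> (A\<^sub>1 *v w))"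
  by (simp add: param_matrix_def matrix_vector_mult_add_rdistrib inner_add_right
      scaleR_matrix_vector_assoc[symmetric])

lemma param_sym: "v \<bullet> (param_matrix A\<^sub>0 A\<^sub>1 y *v w) = w \<bullet> (param_matrix A\<^sub>0 A\<^sub>1 y *v v)"
  using sym[of v w] sym1[of v w] by (simp add: inner_param_matrix)

text \<open>Since \<open>y > -1\<close>, the perturbation lowers the energy by at most that of
  \<open>A\<^sub>1\<close>, hence by at most the fraction \<open>1 - r\<close> of that of
  \<open>A\<^sub>0\<close>.\<close>

lemma param_lower:
  assumes "y \<in> {-1<..<1}"
  shows "r * (energy_norm A\<^sub>0 v)\<^sup>2 \<le> v \<bullet> (param_matrix A\<^sub>0 A\<^sub>1 y *v v)"
proof -
  have "- (y * (v \<bullet> (A\<^sub>1 *v v))) \<le> 1 * (v \<bullet> (A\<^sub>1 *v v))"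
    using assms psd1[of v] by (subst minus_mult_left, intro mult_right_mono) auto
  then show ?thesis
    using upper1[of v] by (simp add: inner_param_matrix energy_norm_sq algebra_simps)
qed

lemma param_upper:
  assumes "y \<in> {-1<..<1}"
  shows "v \<bullet> (param_matrix A\<^sub>0 A\<^sub>1 y *v v) \<le> (1 + C) * (energy_norm A\<^sub>0 v)\<^sup>2"
proof -
  have "y * (v \<bullet> (A\<^sub>1 *v v)) \<le> 1 * (v \<bullet> (A\<^sub>1 *v v))"
    using assms psd1[of v] by (intro mult_right_mono) auto
  also have "\<dots> \<le> C * (energy_norm A\<^sub>0 v)\<^sup>2"
    using bound1[of v v] by (simp add: power2_eq_square mult.assoc)
  finally show ?thesis
    by (simp add: inner_param_matrix energy_norm_sq algebra_simps)
qed

text \<open>By Galerkin orthogonality and symmetry, \<open>u\<close> is the best approximation from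
  \<open>V\<close> in the energy of \<open>A(y)\<close>. Passing to the energy of
  \<open>A\<^sub>0\<close> on both sides costs the factor \<open>(1 + C) / r\<close>, that is,
  \<open>\<kappa>\<close> squared.\<close>

lemma cea:
  assumes y: "y \<in> {-1<..<1}" and V: "subspace V" and x: "param_matrix A\<^sub>0 A\<^sub>1 y *v x = b"
    and u: "u \<in> V" "\<And>v. v \<in> V \<Longrightarrow> v \<bullet> (param_matrix A\<^sub>0 A\<^sub>1 y *v u) = v \<bullet> b" and p: "p \<in> V"
  shows "(energy_norm A\<^sub>0 (x - u))\<^sup>2 \<le> (1 + C) / r * (energy_norm A\<^sub>0 (x - p))\<^sup>2"
proof -
  let ?A = "param_matrix A\<^sub>0 A\<^sub>1 y"
  define d where "d = u - p"
  have "d \<in> V" using u(1) p V by (simp add: d_def subspace_diff)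
  then have orth: "d \<bullet> (?A *v (x - u)) = 0"
    using u(2) x by (simp add: matrix_vector_mult_diff_distrib inner_diff_right)
  have "(x - p) \<bullet> (?A *v (x - p)) = (x - u + d) \<bullet> (?A *v (x - u + d))" by (simp add: d_def)
  also have "\<dots> = (x - u) \<bullet> (?A *v (x - u)) + d \<bullet> (?A *v d)"
    using orth param_sym[of d y "x - u"]
    by (simp add: matrix_vector_right_distrib inner_add_left inner_add_right)
  also have "\<dots> \<ge> (x - u) \<bullet> (?A *v (x - u))"
  proof -
    have "0 \<le> r * (energy_norm A\<^sub>0 d)\<^sup>2" using r_pos by simp
    also have "\<dots> \<le> d \<bullet> (?A *v d)" by (rule param_lower[OF y])
    finally show ?thesis by simp
  qed
  finally have "r * (energy_norm A\<^sub>0 (x - u))\<^sup>2 \<le> (1 + C) * (energy_norm A\<^sub>0 (x - p))\<^sup>2"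
    using param_lower[OF y, of "x - u"] param_upper[OF y, of "x - p"] by linarith
  then show ?thesis using r_pos by (simp add: field_simps)
qed

text \<open>Testing the equations at \<open>y\<close> and \<open>y0\<close> with the difference of
  the solutions leaves \<open>y0 - y\<close> times an \<open>A\<^sub>1\<close> term; the lower bound
  for \<open>A(y)\<close> turns this into a Lipschitz estimate at \<open>y0\<close>. With
  \<open>V = UNIV\<close> it applies to \<open>x\<close> itself. Continuity later gives
  measurability and turns essential suprema into suprema.\<close>

lemma galerkin_continuous:
  assumes V: "subspace V"
    and u: "\<And>y. y \<in> {-1<..<1} \<Longrightarrow> u y \<in> V"
      "\<And>y v. y \<in> {-1<..<1} \<Longrightarrow> v \<in> V \<Longrightarrow> v \<bullet> (param_matrix A\<^sub>0 A\<^sub>1 y *v u y) = v \<bullet> b"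
  shows "continuous_on {-1<..<1} u"
  unfolding continuous_on_def
proof
  fix y0 :: real assume y0: "y0 \<in> {-1<..<1}"
  obtain \<gamma> where \<gamma>: "\<gamma> > 0" "\<And>v. \<gamma> * norm v \<le> energy_norm A\<^sub>0 v" using energy_norm_lower by blast
  let ?E = "energy_norm A\<^sub>0"
  define M where "M = C * ?E (u y0) / (r * \<gamma>)"
  have est: "norm (u y - u y0) \<le> \<bar>y - y0\<bar> * M" if y: "y \<in> {-1<..<1}" for y
  proof -
    define d where "d = u y - u y0"
    have "d \<in> V" using u(1) y y0 V by (simp add: d_def subspace_diff)
    have "r * (?E d)\<^sup>2 \<le> d \<bullet> (param_matrix A\<^sub>0 A\<^sub>1 y *v d)" by (rule param_lower[OF y])
    also have "\<dots> = d \<bullet> b - d \<bullet> (param_matrix A\<^sub>0 A\<^sub>1 y *v u y0)"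
      using u(2)[OF y \<open>d \<in> V\<close>]
      by (subst (2) d_def) (simp add: matrix_vector_mult_diff_distrib inner_diff_right)
    also have "\<dots> = (y0 - y) * (d \<bullet> (A\<^sub>1 *v u y0))"
      using u(2)[OF y0 \<open>d \<in> V\<close>] by (simp add: inner_param_matrix algebra_simps)
    also have "\<dots> \<le> \<bar>y - y0\<bar> * \<bar>d \<bullet> (A\<^sub>1 *v u y0)\<bar>"
      by (metis abs_ge_self abs_minus_commute abs_mult)
    also have "\<dots> \<le> \<bar>y - y0\<bar> * (C * ?E d * ?E (u y0))"
      by (intro mult_left_mono bound1) simp
    finally have "?E d * (r * ?E d) \<le> ?E d * (\<bar>y - y0\<bar> * (C * ?E (u y0)))"
      by (simp add: power2_eq_square mult_ac)
    \<comment> \<open>One factor \<open>?E d\<close> is cancelled; when it is 0 the claim holds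
      because the right-hand side is nonnegative.\<close>
    then have "r * ?E d \<le> \<bar>y - y0\<bar> * (C * ?E (u y0))"
      using energy_norm_nonneg[of d] energy_norm_nonneg[of "u y0"] C_pos
      by (cases "?E d = 0") (auto simp: mult_le_cancel_left)
    moreover have "r * (\<gamma> * norm d) \<le> r * ?E d"
      using \<gamma>(2)[of d] r_pos by simp
    ultimately have "r * \<gamma> * norm d \<le> \<bar>y - y0\<bar> * (C * ?E (u y0))" by simp
    then show ?thesis
      using r_pos \<gamma>(1) by (simp add: M_def d_def field_simps)
  qed
  have "((\<lambda>y. \<bar>y - y0\<bar> * M) \<longlongrightarrow> \<bar>y0 - y0\<bar> * M) (at y0 within {-1<..<1})"
    by (intro tendsto_intros)
  then have lim: "((\<lambda>y. \<bar>y - y0\<bar> * M) \<longlongrightarrow> 0) (at y0 within {-1<..<1})" by simp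
  have "((\<lambda>y. u y - u y0) \<longlongrightarrow> 0) (at y0 within {-1<..<1})"
    by (rule Lim_null_comparison[OF _ lim]) (use est in \<open>auto simp: eventually_at_filter\<close>)
  then show "(u \<longlongrightarrow> u y0) (at y0 within {-1<..<1})" by (rule LIM_zero_cancel)
qed

end

section \<open>The error estimate\<close>

text \<open>Bridge from the Lebesgue integral in \<open>L2_norm\<close> to the gauge integral in
  \<open>quadrature_error\<close>. An upper bound suffices, so the open interval is enlarged to the
  closed one.\<close>

lemma nn_integral_lebesgue_on_le_integral:
  fixes h :: "real \<Rightarrow> real"
  assumes "continuous_on {a..b} h" and "\<And>y. y \<in> {a..b} \<Longrightarrow> 0 \<le> h y"
  shows "(\<integral>\<^sup>+ y. ennreal (h y) \<partial>lebesgue_on {a<..<b}) \<le> ennreal (integral {a..b} h)"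
proof -
  have "(\<integral>\<^sup>+ y. ennreal (h y) \<partial>lebesgue_on {a<..<b}) =
      (\<integral>\<^sup>+ y. ennreal (h y) * indicator {a<..<b} y \<partial>lebesgue)"
    by (rule nn_integral_restrict_space) simp
  also have "\<dots> \<le> (\<integral>\<^sup>+ y. ennreal (h y) * indicator {a..b} y \<partial>lebesgue)"
    by (intro nn_integral_mono) (auto simp: indicator_def)
  also have "\<dots> = ennreal (integral {a..b} h)"
    unfolding nn_integral_completion
    by (rule nn_integral_has_integral_lebesgue'[OF assms(2)])
      (auto intro!: integrable_integral integrable_continuous_real assms(1))
  finally show ?thesis .
qed

context spd_matrix
begin

text \<open>The quadrature bound for scalar polynomials passes to vector-valued ones because the energy is a
  sum of squares of linear functionals.\<close>

lemma integral_energy_least_squares_le: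
  fixes f :: "nat \<Rightarrow> real^'m"
  assumes deg: "\<And>i. degree (l i) \<le> n"
    and contr: "\<And>g. (\<Sum>k=1..N. (\<Sum>i=1..N. g i * poly (l i) (ys k))\<^sup>2 * ws k) \<le> (\<Sum>k=1..N. (g k)\<^sup>2 * ws k)"
  shows "(1 - quadrature_error n N ys ws) *
      integral {-1..1} (\<lambda>y. (energy_norm A (\<Sum>i=1..N. poly (l i) y *\<^sub>R f i))\<^sup>2) \<le>
    (\<Sum>k=1..N. (energy_norm A (f k))\<^sup>2 * ws k)"
proof -
  obtain ds where ds: "\<And>v. v \<bullet> (A *v v) = (\<Sum>d\<leftarrow>ds. (d \<bullet> v)\<^sup>2)"
    using bilinear_psd_sum_of_squares[OF bilinear_matrix sym nonneg] by blast
  have E: "(energy_norm A v)\<^sup>2 = (\<Sum>m<length ds. (ds ! m \<bullet> v)\<^sup>2)" for v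
    by (simp add: energy_norm_sq ds sum_list_sum_nth atLeast0LessThan)
  \<comment> \<open>The scalar polynomial obtained by applying the functional \<open>ds ! m\<close>
    to the vector-valued fit; it is the fit to the scalar data
    \<open>ds ! m \<bullet> f i\<close>.\<close>
  define p where "p m = (\<Sum>i=1..N. smult (ds ! m \<bullet> f i) (l i))" for m
  have poly_p: "poly (p m) y = (\<Sum>i=1..N. (ds ! m \<bullet> f i) * poly (l i) y)" for m y
    by (simp add: p_def poly_sum)
  have deg_p: "degree (p m) \<le> n" for m
    unfolding p_def by (intro degree_sum_le) (auto simp: deg)
  have inner: "ds ! m \<bullet> (\<Sum>i=1..N. poly (l i) y *\<^sub>R f i) = poly (p m) y" for m y
    by (simp add: poly_p inner_sum_right mult.commute)
  let ?e = "quadrature_error n N ys ws"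
  have "(1 - ?e) * integral {-1..1} (\<lambda>y. (energy_norm A (\<Sum>i=1..N. poly (l i) y *\<^sub>R f i))\<^sup>2) =
      (1 - ?e) * (\<Sum>m<length ds. integral {-1..1} (\<lambda>y. (poly (p m) y)\<^sup>2))"
    unfolding E inner
    by (subst integral_sum) (auto intro!: integrable_continuous_real continuous_intros)
  also have "\<dots> \<le> (\<Sum>m<length ds. \<Sum>k=1..N. (poly (p m) (ys k))\<^sup>2 * ws k)"
    unfolding sum_distrib_left by (intro sum_mono integral_le_discrete deg_p)
  also have "\<dots> \<le> (\<Sum>m<length ds. \<Sum>k=1..N. (ds ! m \<bullet> f k)\<^sup>2 * ws k)"
    unfolding poly_p by (intro sum_mono contr)
  also have "\<dots> = (\<Sum>k=1..N. (energy_norm A (f k))\<^sup>2 * ws k)"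
    unfolding E sum_distrib_right by (rule sum.swap)
  finally show ?thesis .
qed

end

section \<open>Vector-valued polynomials through nodal values\<close>

lemma vec_poly_space_sum:
  fixes c :: "nat \<Rightarrow> real^'m"
  assumes "\<And>i. degree (l i) \<le> n"
  shows "(\<lambda>y. \<Sum>i=1..N. poly (l i) y *\<^sub>R c i) \<in> vec_poly_space n"
proof -
  have "(\<lambda>y. \<Sum>i=1..N. poly (l i) y *\<^sub>R c i) =
      (\<lambda>y. \<chi> j. poly (\<Sum>i=1..N. smult (c i $ j) (l i)) y)"
    by (auto simp: fun_eq_iff vec_eq_iff poly_sum mult.commute)
  moreover have "(\<Sum>i=1..N. smult (c i $ j) (l i)) \<in> poly_space n" for j
    unfolding poly_space_def mem_Collect_eq using assms by (intro degree_sum_le) auto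
  ultimately show ?thesis unfolding vec_poly_space_def by (intro CollectI) (rule exI, auto)
qed

text \<open>Scalar reproduction holds in each component. A vector polynomial is thus determined by
  its nodal values, as the best-approximation argument requires.\<close>

lemma vec_poly_space_repr:
  fixes q :: "real \<Rightarrow> real^'m"
  assumes "\<And>q y. degree q \<le> n \<Longrightarrow> poly q y = (\<Sum>i=1..N. poly q (ys i) * poly (l i) y)"
    and "q \<in> vec_poly_space n"
  shows "q y = (\<Sum>i=1..N. poly (l i) y *\<^sub>R q (ys i))"
proof -
  obtain c where c: "q = (\<lambda>y. \<chi> j. poly (c j) y)" "\<And>j. degree (c j) \<le> n"
    using assms(2) by (auto simp: vec_poly_space_def poly_space_def)
  show ?thesis
    unfolding vec_eq_iff
  proof
    fix j
    show "q y $ j = (\<Sum>i=1..N. poly (l i) y *\<^sub>R q (ys i)) $ j"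
      using assms(1)[OF c(2), of j y] by (simp add: c(1) mult.commute)
  qed
qed

context parametric_spd
begin

lemma subspace_solution_error:
  fixes n N :: nat and ys ws :: "nat \<Rightarrow> real" and x xt :: "real \<Rightarrow> real^'m" and b :: "real^'m"
  assumes ys: "\<And>i. i \<in> {1..N} \<Longrightarrow> ys i \<in> {-1<..<1}"
    and ws: "\<And>i. i \<in> {1..N} \<Longrightarrow> 0 < ws i"
    and ip: "inner_product_on (poly_space n) (discrete_form N ys ws)"
    and ws_sum: "(\<Sum>i=1..N. ws i) = 2"
    and x: "\<And>y. y \<in> {-1<..<1} \<Longrightarrow> param_matrix A\<^sub>0 A\<^sub>1 y *v x y = b"
    and xt: "\<And>y. y \<in> {-1<..<1} \<Longrightarrow>
      subspace_solution (param_matrix A\<^sub>0 A\<^sub>1 y) b (span ((\<lambda>i. x (ys i)) ` {1..N})) (xt y)"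
    and e: "quadrature_error n N ys ws < 1"
    and \<sigma>: "\<sigma> > 0" "2 / (1 - quadrature_error n N ys ws) \<le> \<sigma>\<^sup>2"
  shows "L2_norm A\<^sub>0 (\<lambda>y. x y - xt y) \<le>
    ennreal (sqrt ((1 + C) / r) * (sqrt 2 + \<sigma>)) *
      (LEAST v. \<exists>q \<in> vec_poly_space n. v = Linf_norm A\<^sub>0 (\<lambda>y. x y - q y))"
proof -
  let ?S = "{-1<..<1::real}"
  let ?E = "energy_norm A\<^sub>0"
  define V where "V = span ((\<lambda>i. x (ys i)) ` {1..N})"
  have V: "subspace V" by (simp add: V_def)
  have xt_V: "\<And>y. y \<in> ?S \<Longrightarrow> xt y \<in> V"
    "\<And>y v. y \<in> ?S \<Longrightarrow> v \<in> V \<Longrightarrow> v \<bullet> (param_matrix A\<^sub>0 A\<^sub>1 y *v xt y) = v \<bullet> b"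
    using subspace_solution_orthogonal[OF xt] by (simp_all add: V_def)
  have cont_x: "continuous_on ?S x"
    by (rule galerkin_continuous[of UNIV _ b]) (simp_all add: x)
  have cont_xt: "continuous_on ?S xt"
    using galerkin_continuous[OF V] xt_V by blast
  have "0 < (\<Sum>i=1..N. (poly f (ys i))\<^sup>2 * ws i)" if "degree f \<le> n" "f \<noteq> 0" for f
    using ip that by (simp add: inner_product_on_def discrete_form_def poly_space_def power2_eq_square)
  from least_squares_basis[of n ys ws N, OF this ws] obtain l where
    deg: "\<And>i. degree (l i) \<le> n"
    and repr: "\<And>q y. degree q \<le> n \<Longrightarrow> poly q y = (\<Sum>i=1..N. poly q (ys i) * poly (l i) y)"
    and contr: "\<And>g. (\<Sum>k=1..N. (\<Sum>i=1..N. g i * poly (l i) (ys k))\<^sup>2 * ws k) \<le> (\<Sum>k=1..N. (g k)\<^sup>2 * ws k)"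
    by blast
  have vec_repr: "q y = (\<Sum>i=1..N. poly (l i) y *\<^sub>R q (ys i))"
    if "q \<in> vec_poly_space n" for q :: "real \<Rightarrow> real^'m" and y
    using repr that by (rule vec_poly_space_repr)
  obtain q where q: "q \<in> vec_poly_space n"
    and q_min: "\<And>p. p \<in> vec_poly_space n \<Longrightarrow>
      Linf_norm A\<^sub>0 (\<lambda>y. x y - q y) \<le> Linf_norm A\<^sub>0 (\<lambda>y. x y - p y)"
  proof (rule best_approximation_exists[where x = x and I = "{1..N}" and t = ys
        and l = "\<lambda>i. poly (l i)" and F = "vec_poly_space n"])
    show "(\<lambda>y. \<Sum>i=1..N. poly (l i) y *\<^sub>R c i) \<in> vec_poly_space n" for c :: "nat \<Rightarrow> real^'m"
      using deg by (rule vec_poly_space_sum)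
  qed (use cont_x ys vec_repr in \<open>auto intro!: continuous_intros\<close>)
  have least: "(LEAST v. \<exists>q \<in> vec_poly_space n. v = Linf_norm A\<^sub>0 (\<lambda>y. x y - q y)) =
      Linf_norm A\<^sub>0 (\<lambda>y. x y - q y)"
    by (rule Least_equality) (use q q_min in auto)
  define \<kappa> where "\<kappa> = sqrt ((1 + C) / r)"
  have \<kappa>: "\<kappa> > 0" "\<kappa>\<^sup>2 = (1 + C) / r" using r_pos C_pos by (simp_all add: \<kappa>_def)
  define K where "K = \<kappa> * (sqrt 2 + \<sigma>)"
  have K: "0 < K" using \<kappa>(1) \<sigma>(1) by (simp add: K_def add_pos_pos)
  show ?thesis
  proof (cases "Linf_norm A\<^sub>0 (\<lambda>y. x y - q y)")
    case top
    show ?thesis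
      unfolding least top \<kappa>_def[symmetric] K_def[symmetric] using K by (simp add: ennreal_mult_top)
  next
    case (real \<mu>)
    have cont_q: "continuous_on ?S q"
    proof -
      have "continuous_on ?S (\<lambda>y. \<Sum>i=1..N. poly (l i) y *\<^sub>R q (ys i))"
        by (intro continuous_intros)
      then show ?thesis by (rule continuous_on_eq) (rule vec_repr[OF q, symmetric])
    qed
    have xq: "?E (x y - q y) \<le> \<mu>" if "y \<in> ?S" for y
      using Linf_norm_le_iff[OF continuous_on_diff[OF cont_x cont_q] real(1)] real(2) that by simp
    define f where "f i = q (ys i) - x (ys i)" for i
    define p where "p y = (\<Sum>i=1..N. poly (l i) y *\<^sub>R x (ys i))" for y
    define s where "s y = (\<Sum>i=1..N. poly (l i) y *\<^sub>R f i)" for y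
    have p_V: "p y \<in> V" for y
      unfolding p_def V_def by (intro span_sum span_scale span_base) auto
    \<comment> \<open>The fit reproduces \<open>q\<close>, so fitting the data \<open>q - x\<close>
      gives \<open>q - p\<close>.\<close>
    have s_eq: "s y = q y - p y" for y
      unfolding vec_repr[OF q, of y] by (simp add: s_def p_def f_def scaleR_diff_right sum_subtractf)
    have cont_s: "continuous_on T s" for T
      unfolding s_def by (intro continuous_intros)
    define G where "G = integral {-1..1} (\<lambda>y. (?E (s y))\<^sup>2)"
    have "(1 - quadrature_error n N ys ws) * G \<le> (\<Sum>k=1..N. (?E (f k))\<^sup>2 * ws k)"
      unfolding G_def s_def using deg contr by (rule integral_energy_least_squares_le)
    also have "\<dots> \<le> (\<Sum>k=1..N. \<mu>\<^sup>2 * ws k)"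
    proof (intro sum_mono mult_right_mono power_mono energy_norm_nonneg)
      fix k assume k: "k \<in> {1..N}"
      show "?E (f k) \<le> \<mu>"
        unfolding f_def energy_norm_minus_commute[of "q (ys k)"] by (rule xq[OF ys[OF k]])
      show "0 \<le> ws k" using ws[OF k] by simp
    qed
    also have "\<dots> = 2 * \<mu>\<^sup>2"
      unfolding sum_distrib_left[symmetric] ws_sum by simp
    finally have "G \<le> 2 / (1 - quadrature_error n N ys ws) * \<mu>\<^sup>2"
      using e by (simp add: field_simps)
    also have "\<dots> \<le> \<sigma>\<^sup>2 * \<mu>\<^sup>2" by (intro mult_right_mono \<sigma>(2)) simp
    finally have G: "G \<le> \<sigma>\<^sup>2 * \<mu>\<^sup>2" .
    \<comment> \<open>Weight for \<open>(a + b)\<^sup>2 \<le> (1 + t) a\<^sup>2 + (1 + 1 / t) b\<^sup>2\<close>, optimal for \<open>b = \<sigma> a / sqrt 2\<close>; it avoids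
      Minkowski's inequality.\<close>
    define t where "t = \<sigma> / sqrt 2"
    have t: "t > 0" using \<sigma>(1) by (simp add: t_def)
    \<comment> \<open>This majorant involves \<open>y\<close> only through the polynomial
      \<open>s\<close>, so it is continuous up to the endpoints, where nothing is assumed about
      \<open>x\<close>.\<close>
    define h where "h y = \<kappa>\<^sup>2 * ((1 + t) * \<mu>\<^sup>2 + (1 + 1 / t) * (?E (s y))\<^sup>2)" for y
    have pointwise: "(?E (x y - xt y))\<^sup>2 \<le> h y" if y: "y \<in> ?S" for y
    proof -
      have "?E (x y - p y) \<le> ?E (x y - q y) + ?E (s y)"
        using energy_norm_triangle[of "x y - q y" "s y"] by (simp add: s_eq)
      also have "\<dots> \<le> \<mu> + ?E (s y)" using xq[OF y] by simp
      finally have "(?E (x y - p y))\<^sup>2 \<le> (\<mu> + ?E (s y))\<^sup>2"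
        by (intro power_mono energy_norm_nonneg)
      also have "\<dots> \<le> (1 + t) * \<mu>\<^sup>2 + (1 + 1 / t) * (?E (s y))\<^sup>2"
      proof -
        have "0 \<le> (t * \<mu> - ?E (s y))\<^sup>2 / t" using t by simp
        also have "\<dots> = (1 + t) * \<mu>\<^sup>2 + (1 + 1 / t) * (?E (s y))\<^sup>2 - (\<mu> + ?E (s y))\<^sup>2"
          using t by (simp add: field_simps power2_eq_square)
        finally show ?thesis by simp
      qed
      finally have "\<kappa>\<^sup>2 * (?E (x y - p y))\<^sup>2 \<le> h y"
        unfolding h_def by (intro mult_left_mono) auto
      then show ?thesis
        using cea[OF y V x[OF y] xt_V(1)[OF y] xt_V(2)[OF y] p_V[of y]] \<kappa>(2) by simp
    qed
    have cont_E: "continuous_on {-1..1} (\<lambda>y. (?E (s y))\<^sup>2)"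
      by (intro continuous_intros cont_s)
    have "integral {-1..1} h = \<kappa>\<^sup>2 * (2 * ((1 + t) * \<mu>\<^sup>2) + (1 + 1 / t) * G)"
    proof -
      have "(\<lambda>y. (1 + 1 / t) * (?E (s y))\<^sup>2) integrable_on {-1..1}"
        by (intro integrable_continuous_real continuous_on_mult_left cont_E)
      then have "integral {-1..1} (\<lambda>y. (1 + t) * \<mu>\<^sup>2 + (1 + 1 / t) * (?E (s y))\<^sup>2) =
          2 * ((1 + t) * \<mu>\<^sup>2) + (1 + 1 / t) * G"
        unfolding G_def by (subst integral_add) (simp_all add: integrable_const_ivl)
      then show ?thesis by (simp add: h_def[abs_def])
    qed
    also have "\<dots> \<le> \<kappa>\<^sup>2 * (2 * ((1 + t) * \<mu>\<^sup>2) + (1 + 1 / t) * (\<sigma>\<^sup>2 * \<mu>\<^sup>2))"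
      using G t by (intro mult_left_mono add_left_mono) auto
    \<comment> \<open>With \<open>\<sigma> = sqrt 2 * t\<close> both terms share the factor
      \<open>2 * (1 + t)\<close>, and their sum becomes a perfect square.\<close>
    also have "\<dots> = (K * \<mu>)\<^sup>2"
    proof -
      have sq: "\<sigma>\<^sup>2 = 2 * t\<^sup>2" "(sqrt 2 + \<sigma>)\<^sup>2 = 2 * (1 + t)\<^sup>2"
        using \<sigma>(1) by (simp_all add: t_def power_divide power2_sum field_simps)
      show ?thesis
        unfolding K_def power_mult_distrib sq using t by (simp add: field_simps power2_eq_square)
    qed
    finally have int_h: "integral {-1..1} h \<le> (K * \<mu>)\<^sup>2" .
    define I where "I = (\<integral>\<^sup>+ y. ennreal ((?E (x y - xt y))\<^sup>2) \<partial>lebesgue_on ?S)"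
    have "I \<le> (\<integral>\<^sup>+ y. ennreal (h y) \<partial>lebesgue_on ?S)"
      unfolding I_def by (intro nn_integral_mono ennreal_leI pointwise) simp
    also have "\<dots> \<le> ennreal (integral {-1..1} h)"
    proof (rule nn_integral_lebesgue_on_le_integral)
      show "continuous_on {-1..1} h" unfolding h_def by (intro continuous_intros cont_s)
      show "0 \<le> h y" for y using t by (simp add: h_def)
    qed
    also have "\<dots> \<le> ennreal ((K * \<mu>)\<^sup>2)" using int_h by (rule ennreal_leI)
    finally have I: "I \<le> ennreal ((K * \<mu>)\<^sup>2)" .
    \<comment> \<open>Measurability and finiteness of \<open>I\<close> exclude the default value
      infinity of \<open>L2_norm\<close>.\<close>
    have meas: "(\<lambda>y. x y - xt y) \<in> borel_measurable (lebesgue_on ?S)"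
      by (intro continuous_imp_measurable_on_sets_lebesgue continuous_on_diff cont_x cont_xt) auto
    have "I < \<infinity>" using I by (simp add: le_less_trans)
    then have "L2_norm A\<^sub>0 (\<lambda>y. x y - xt y) = ennreal (sqrt (enn2real I))"
      using meas by (simp add: L2_norm_def I_def Let_def)
    also have "\<dots> \<le> ennreal (K * \<mu>)"
    proof (rule ennreal_leI)
      have "enn2real I \<le> (K * \<mu>)\<^sup>2" using I by (intro enn2real_leI) auto
      then show "sqrt (enn2real I) \<le> K * \<mu>"
        using K real(1) by (intro real_le_lsqrt) auto
    qed
    also have "\<dots> = ennreal K * ennreal \<mu>" using K real(1) by (simp add: ennreal_mult)
    finally show ?thesis unfolding least real(2) K_def \<kappa>_def .
  qed
qed

end

section \<open>From forms to matrices\<close>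

text \<open>Linearity is assumed in the first argument only; symmetry transfers the expansion to the
  second.\<close>

lemma form_matrix_inner:
  fixes a :: "('a::euclidean_space \<Rightarrow> real) \<Rightarrow> ('a \<Rightarrow> real) \<Rightarrow> real" and \<phi> :: "'m::finite \<Rightarrow> 'a \<Rightarrow> real"
  assumes a: "symmetric_continuous_bilinear_H10 \<Omega> a" and X: "subspace_H10 \<Omega> X" and \<phi>: "\<And>i. \<phi> i \<in> X"
  shows "(\<lambda>z. \<Sum>i\<in>UNIV. v $ i * \<phi> i z) \<in> X"
    and "v \<bullet> (form_matrix a \<phi> *v w) = a (\<lambda>z. \<Sum>i\<in>UNIV. v $ i * \<phi> i z) (\<lambda>z. \<Sum>i\<in>UNIV. w $ i * \<phi> i z)"
proof -
  have XH: "u \<in> H10 \<Omega>" if "u \<in> X" for u using X that by (auto simp: subspace_H10_def)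
  have add: "a (\<lambda>z. u z + v z) w = a u w + a v w" if "u \<in> X" "v \<in> X" "w \<in> X" for u v w
    using a that[THEN XH] unfolding symmetric_continuous_bilinear_H10_def by blast
  have scale: "a (\<lambda>z. c * u z) w = c * a u w" if "u \<in> X" "w \<in> X" for c u w
    using a that[THEN XH] unfolding symmetric_continuous_bilinear_H10_def by blast
  have mem: "(\<lambda>z. \<Sum>i\<in>J. c i * \<phi> i z) \<in> X" if "finite J" for J c
    using that
  proof (induction J rule: finite_induct)
    case (insert j J)
    have "(\<lambda>z. c j * \<phi> j z) \<in> X" using X \<phi> by (auto simp: subspace_H10_def)
    then show ?case using X insert by (simp add: subspace_H10_def)
  qed (use X in \<open>simp add: subspace_H10_def\<close>)
  then show "(\<lambda>z. \<Sum>i\<in>UNIV. v $ i * \<phi> i z) \<in> X" by simp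
  have comb: "a (\<lambda>z. \<Sum>i\<in>J. c i * \<phi> i z) u = (\<Sum>i\<in>J. c i * a (\<phi> i) u)"
    if "finite J" "u \<in> X" for J c u
    using that(1)
  proof (induction J rule: finite_induct)
    case empty
    \<comment> \<open>The form vanishes at the zero function because that function is 0 times
      \<open>u\<close>.\<close>
    have "a (\<lambda>z. 0 * u z) u = 0 * a u u"
      by (intro scale that(2))
    then show ?case by simp
  next
    case (insert j J)
    have "(\<lambda>z. c j * \<phi> j z) \<in> X" using X \<phi> by (auto simp: subspace_H10_def)
    then have "a (\<lambda>z. c j * \<phi> j z + (\<Sum>i\<in>J. c i * \<phi> i z)) u =
        a (\<lambda>z. c j * \<phi> j z) u + a (\<lambda>z. \<Sum>i\<in>J. c i * \<phi> i z) u"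
      by (intro add mem insert(1) that(2))
    moreover have "a (\<lambda>z. c j * \<phi> j z) u = c j * a (\<phi> j) u"
      by (intro scale \<phi> that(2))
    ultimately show ?case using insert by simp
  qed
  have sym: "a u w = a w u" if "u \<in> X" "w \<in> X" for u w
    using a that[THEN XH] unfolding symmetric_continuous_bilinear_H10_def by blast
  let ?w = "\<lambda>z. \<Sum>i\<in>UNIV. w $ i * \<phi> i z"
  have w: "?w \<in> X" by (rule mem) simp
  have row: "a (\<phi> i) ?w = (\<Sum>j\<in>UNIV. w $ j * a (\<phi> i) (\<phi> j))" for i
    unfolding sym[OF \<phi> w] sym[OF \<phi>[of i] \<phi>] by (rule comb) (simp_all add: \<phi>)
  have "a (\<lambda>z. \<Sum>i\<in>UNIV. v $ i * \<phi> i z) ?w = (\<Sum>i\<in>UNIV. v $ i * a (\<phi> i) ?w)"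
    using w by (intro comb) simp_all
  also have "\<dots> = v \<bullet> (form_matrix a \<phi> *v w)"
    by (simp add: row inner_vec_def matrix_vector_mult_def form_matrix_def mult.commute)
  finally show "v \<bullet> (form_matrix a \<phi> *v w) = a (\<lambda>z. \<Sum>i\<in>UNIV. v $ i * \<phi> i z) ?w" by simp
qed

text \<open>The \<open>L2\<close> part is already positive, whichever weak gradient the choice
  operator selects.\<close>

lemma H1_norm_pos:
  assumes "u \<in> H1 \<Omega>" and "\<not> (AE z in lebesgue_on \<Omega>. u z = 0)"
  shows "0 < H1_norm \<Omega> u"
proof -
  have "integrable (lebesgue_on \<Omega>) (\<lambda>z. (u z)\<^sup>2)"
    using assms(1) by (auto simp: H1_def L2_def)
  then have "integral\<^sup>L (lebesgue_on \<Omega>) (\<lambda>z. (u z)\<^sup>2) \<noteq> 0"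
    using assms(2) integral_nonneg_eq_0_iff_AE[of "lebesgue_on \<Omega>" "\<lambda>z. (u z)\<^sup>2"] by simp
  moreover have "0 \<le> integral\<^sup>L (lebesgue_on \<Omega>) (\<lambda>z. (u z)\<^sup>2)" by simp
  ultimately have "0 < integral\<^sup>L (lebesgue_on \<Omega>) (\<lambda>z. (u z)\<^sup>2)" by linarith
  then show ?thesis
    unfolding H1_norm_def Let_def by (intro real_sqrt_gt_zero add_pos_nonneg) auto
qed

theorem theorem5p1:
  fixes \<Omega> :: "(real^'d) set"
    and L :: "(real^'d \<Rightarrow> real) \<Rightarrow> real"
    and a\<^sub>0 a\<^sub>1 :: "(real^'d \<Rightarrow> real) \<Rightarrow> (real^'d \<Rightarrow> real) \<Rightarrow> real"
    and r C :: real
    and X\<^sub>h :: "(real^'d \<Rightarrow> real) set"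
    and \<phi> :: "'m::finite \<Rightarrow> real^'d \<Rightarrow> real"
    and A\<^sub>0 A\<^sub>1 :: "real^'m^'m"
    and A :: "real \<Rightarrow> real^'m^'m"
    and b :: "real^'m"
    and n N :: nat
    and ys ws :: "nat \<Rightarrow> real"
    and x xt :: "real \<Rightarrow> real^'m"
    and V :: "(real^'m) set"
    and e \<kappa> C\<^sub>s :: real
  assumes "CARD('d) \<in> {2, 3}"
    and "lipschitz_domain \<Omega>"
    and "bounded_functional_H10 \<Omega> L"
    and "symmetric_continuous_bilinear_H10 \<Omega> a\<^sub>0"
    and "symmetric_continuous_bilinear_H10 \<Omega> a\<^sub>1"
    and "coercive_H10 \<Omega> a\<^sub>0"
    and "positive_semidefinite_H10 \<Omega> a\<^sub>1"
    and "0 < r" and "r < 1"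
    and "\<And>v. v \<in> H10 \<Omega> \<Longrightarrow> a\<^sub>1 v v \<le> (1 - r) * a\<^sub>0 v v"
    and "0 < C"
    and "\<And>v z. v \<in> H10 \<Omega> \<Longrightarrow> z \<in> H10 \<Omega> \<Longrightarrow> \<bar>a\<^sub>1 v z\<bar> \<le> C * sqrt (a\<^sub>0 v v) * sqrt (a\<^sub>0 z z)"
    and "subspace_H10 \<Omega> X\<^sub>h"
    and "basis_H10 \<Omega> X\<^sub>h \<phi>"
    and "A\<^sub>0 = form_matrix a\<^sub>0 \<phi>"
    and "A\<^sub>1 = form_matrix a\<^sub>1 \<phi>"
    and "A = param_matrix A\<^sub>0 A\<^sub>1"
    and "b = load_vector L \<phi>"
    and "\<And>i. i \<in> {1..N} \<Longrightarrow> ys i \<in> {-1<..<1}"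
    and "\<And>i. i \<in> {1..N} \<Longrightarrow> 0 < ws i"
    and "inner_product_on (poly_space n) (discrete_form N ys ws)"
    and "(\<Sum>i=1..N. ws i) = 2"
    and "\<And>y. y \<in> {-1<..<1} \<Longrightarrow> A y *v x y = b"
    and "V = span ((\<lambda>i. x (ys i)) ` {1..N})"
    and "\<And>y. y \<in> {-1<..<1} \<Longrightarrow> subspace_solution (A y) b V (xt y)"
    and "e = quadrature_error n N ys ws"
    and "e < 1"
    and "\<kappa> = sqrt ((1 + C) / r)"
    and "C\<^sub>s = sqrt ((2 * real n + 2) / (1 - e))"
  shows "L2_norm A\<^sub>0 (\<lambda>y. x y - xt y) \<le>
    ennreal (\<kappa> * (sqrt 2 + C\<^sub>s)) *
      (LEAST v. \<exists>q \<in> vec_poly_space n. v = Linf_norm A\<^sub>0 (\<lambda>y. x y - q y))"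
proof -
  have \<phi>: "\<And>i. \<phi> i \<in> X\<^sub>h" using assms(14) by (simp add: basis_H10_def)
  have XH: "u \<in> H10 \<Omega>" if "u \<in> X\<^sub>h" for u using assms(13) that by (auto simp: subspace_H10_def)
  define comb where "comb v = (\<lambda>z. \<Sum>i\<in>UNIV. v $ i * \<phi> i z)" for v :: "real^'m"
  have comb: "comb v \<in> H10 \<Omega>" for v
    unfolding comb_def by (intro XH form_matrix_inner(1)[OF assms(4,13) \<phi>])
  have A0: "v \<bullet> (A\<^sub>0 *v w) = a\<^sub>0 (comb v) (comb w)" for v w
    unfolding assms(15) comb_def by (rule form_matrix_inner(2)[OF assms(4,13) \<phi>])
  have A1: "v \<bullet> (A\<^sub>1 *v w) = a\<^sub>1 (comb v) (comb w)" for v w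
    unfolding assms(16) comb_def by (rule form_matrix_inner(2)[OF assms(5,13) \<phi>])
  interpret parametric_spd A\<^sub>0 A\<^sub>1 r C
  proof
    show "v \<bullet> (A\<^sub>0 *v w) = w \<bullet> (A\<^sub>0 *v v)" for v w
      using assms(4) comb by (simp add: A0 symmetric_continuous_bilinear_H10_def)
    show "v \<bullet> (A\<^sub>1 *v w) = w \<bullet> (A\<^sub>1 *v v)" for v w
      using assms(5) comb by (simp add: A1 symmetric_continuous_bilinear_H10_def)
    \<comment> \<open>Positive definiteness: linear independence almost everywhere gives
      \<open>comb v\<close> a positive norm, and coercivity transfers this to the form.\<close>
    show "0 < v \<bullet> (A\<^sub>0 *v v)" if "v \<noteq> 0" for v
    proof -
      have "\<not> (AE z in lebesgue_on \<Omega>. comb v z = 0)"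
        using assms(14) that unfolding basis_H10_def comb_def vec_eq_iff by auto
      then have "0 < H1_norm \<Omega> (comb v)"
        using comb[of v] by (intro H1_norm_pos) (auto simp: H10_def)
      moreover obtain \<alpha> where "\<alpha> > 0" "\<alpha> * (H1_norm \<Omega> (comb v))\<^sup>2 \<le> a\<^sub>0 (comb v) (comb v)"
        using assms(6) comb unfolding coercive_H10_def by blast
      ultimately show ?thesis unfolding A0 by (meson less_le_trans mult_pos_pos zero_less_power)
    qed
    show "0 \<le> v \<bullet> (A\<^sub>1 *v v)" for v
      using assms(7) comb by (simp add: A1 positive_semidefinite_H10_def)
    show "v \<bullet> (A\<^sub>1 *v v) \<le> (1 - r) * (v \<bullet> (A\<^sub>0 *v v))" for v
      unfolding A0 A1 by (rule assms(10)[OF comb])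
    show "\<bar>v \<bullet> (A\<^sub>1 *v w)\<bar> \<le> C * energy_norm A\<^sub>0 v * energy_norm A\<^sub>0 w" for v w
      unfolding A0 A1 energy_norm_def by (rule assms(12)[OF comb comb])
  qed (use assms in auto)
  \<comment> \<open>The square of \<open>C\<^sub>s\<close> is \<open>(2 * n + 2) / (1 - e)\<close>,
    which dominates \<open>2 / (1 - e)\<close>.\<close>
  have "C\<^sub>s > 0" and "2 / (1 - e) \<le> C\<^sub>s\<^sup>2"
    using \<open>e < 1\<close> by (simp_all add: assms(29) divide_right_mono)
  then show ?thesis
    using subspace_solution_error[of N ys ws n x b xt C\<^sub>s] assms by simp
qed

end
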